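(* For every $n$ and every $\alpha$ with $0\le\alpha<1$, the complement $\overline{P_n}$ of the path $P_n$ is determined by its $A_\alpha$-spectrum.
   Context: All graphs are finite, simple and undirected. For a graph $G$, $A(G)$ is its adjacency matrix, $D(G)$ its diagonal degree matrix, and $A_\alpha(G)=\alpha D(G)+(1-\alpha)A(G)$. The $A_\alpha$-spectrum of $G$ is the multiset of eigenvalues of $A_\alpha(G)$; $G$ is determined by its $A_\alpha$-spectrum if every graph with the same $A_\alpha$-spectrum is isomorphic to $G$. *)

theory Defs
  imports "Jordan_Normal_Form.Char_Poly" "HOL-Computational_Algebra.Polynomial"
begin

text \<open>A finite simple graph on the vertex set {0..<n}, given by an adjacency relation E
  that is symmetric, irreflexive and supported on {0..<n}. Every finite simple graph is
  isomorphic to one of this form.\<close>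
definition simple_graph :: "nat \<Rightarrow> (nat \<Rightarrow> nat \<Rightarrow> bool) \<Rightarrow> bool" where
  "simple_graph n E \<longleftrightarrow>
     (\<forall>i j. E i j \<longrightarrow> i < n \<and> j < n \<and> i \<noteq> j \<and> E j i)"

definition degree :: "nat \<Rightarrow> (nat \<Rightarrow> nat \<Rightarrow> bool) \<Rightarrow> nat \<Rightarrow> nat" where
  "degree n E i = card {j \<in> {0..<n}. E i j}"

definition adj_matrix :: "nat \<Rightarrow> (nat \<Rightarrow> nat \<Rightarrow> bool) \<Rightarrow> real mat" where
  "adj_matrix n E = mat n n (\<lambda>(i, j). if E i j then 1 else 0)"

definition deg_matrix :: "nat \<Rightarrow> (nat \<Rightarrow> nat \<Rightarrow> bool) \<Rightarrow> real mat" where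
  "deg_matrix n E = mat n n (\<lambda>(i, j). if i = j then real (degree n E i) else 0)"

definition A_alpha :: "real \<Rightarrow> nat \<Rightarrow> (nat \<Rightarrow> nat \<Rightarrow> bool) \<Rightarrow> real mat" where
  "A_alpha \<alpha> n E = \<alpha> \<cdot>\<^sub>m deg_matrix n E + (1 - \<alpha>) \<cdot>\<^sub>m adj_matrix n E"

definition spectrum_mset :: "real mat \<Rightarrow> complex multiset" where
  "spectrum_mset M = proots (map_poly complex_of_real (char_poly M))"

definition A_alpha_spectrum :: "real \<Rightarrow> nat \<Rightarrow> (nat \<Rightarrow> nat \<Rightarrow> bool) \<Rightarrow> complex multiset" where
  "A_alpha_spectrum \<alpha> n E = spectrum_mset (A_alpha \<alpha> n E)"

definition graph_iso :: "nat \<Rightarrow> (nat \<Rightarrow> nat \<Rightarrow> bool) \<Rightarrow> nat \<Rightarrow> (nat \<Rightarrow> nat \<Rightarrow> bool) \<Rightarrow> bool" where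
  "graph_iso m E n F \<longleftrightarrow>
     (\<exists>f. bij_betw f {0..<m} {0..<n} \<and> (\<forall>i<m. \<forall>j<m. E i j \<longleftrightarrow> F (f i) (f j)))"

definition path_graph :: "nat \<Rightarrow> nat \<Rightarrow> nat \<Rightarrow> bool" where
  "path_graph n i j \<longleftrightarrow> i < n \<and> j < n \<and> (i = j + 1 \<or> j = i + 1)"

definition compl_graph :: "nat \<Rightarrow> (nat \<Rightarrow> nat \<Rightarrow> bool) \<Rightarrow> nat \<Rightarrow> nat \<Rightarrow> bool" where
  "compl_graph n E i j \<longleftrightarrow> i < n \<and> j < n \<and> i \<noteq> j \<and> \<not> E i j"

definition determined_by_A_alpha_spectrum ::
  "real \<Rightarrow> nat \<Rightarrow> (nat \<Rightarrow> nat \<Rightarrow> bool) \<Rightarrow> bool" where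
  "determined_by_A_alpha_spectrum \<alpha> n E \<longleftrightarrow>
     (\<forall>m F. simple_graph m F \<and> A_alpha_spectrum \<alpha> m F = A_alpha_spectrum \<alpha> n E
        \<longrightarrow> graph_iso m F n E)"

end

theory Submission
  imports Defs "Jordan_Normal_Form.Schur_Decomposition"
begin

text \<open>Let \<open>H\<close> be the complement of a graph cospectral with the complement of \<open>P\<^sub>n\<close>. Up to a scalar matrix,
  the matrix of the graph itself is \<open>M = (1 - \<alpha>) J - A\<^sub>\<alpha>(H)\<close>, so the power traces of \<open>M\<close> are determined.

  For \<open>\<alpha> > 0\<close> the first two traces give \<open>\<Sum>d\<close> and \<open>\<Sum>d\<^sup>2\<close>, hence \<open>\<Sum>(d - 1)(d - 2) = 0\<close> and all
  degrees of \<open>H\<close> are 1 or 2. For \<open>\<alpha> = 0\<close> the first four traces only give, with \<open>f = d - 2\<close>, that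
  \<open>K = \<Sum>f(f + 1)\<close> is a third of the number of closed 3-walks and that the sum of
  \<open>f(i) f(j)\<close> over ordered adjacent pairs is at least \<open>(2n - 7) K / 2\<close>. Bounding this sum by means of the leaves
  and the vertices of degree at least 3 forces \<open>K = 0\<close>, with the same conclusion on the degrees.

  So \<open>H\<close> is a path together with disjoint cycles. A cycle of length \<open>l\<close> contributes two independent
  eigenvectors orthogonal to the all-ones vector, with eigenvalue \<open>(1 - \<alpha>) g - 2\<close> for
  \<open>g = 2 - 2 cos(2\<pi>/l)\<close>, whereas a double eigenvalue of this form for the path
  itself would force \<open>(n - g)(1 - \<alpha>(1 - \<alpha>) g) = 2\<alpha> - 1\<close>, which is impossible for \<open>n \<ge> l + 2\<close>.\<close>

subsection \<open>Cospectral real matrices\<close>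

definition mtrace :: "'a::comm_ring_1 mat \<Rightarrow> 'a" where
  "mtrace A = (\<Sum>i<dim_row A. A $$ (i,i))"

lemma mtrace_mult:
  assumes "A \<in> carrier_mat n m" "B \<in> carrier_mat m n"
  shows "mtrace (A * B) = (\<Sum>i<n. \<Sum>j<m. A $$ (i,j) * B $$ (j,i))"
  using assms by (auto simp: mtrace_def scalar_prod_def atLeast0LessThan intro!: sum.cong)

lemma mtrace_mult_commute:
  assumes "A \<in> carrier_mat n m" "B \<in> carrier_mat m n"
  shows "mtrace (A * B) = mtrace (B * A)"
  unfolding mtrace_mult[OF assms] mtrace_mult[OF assms(2,1)]
  by (subst sum.swap) (simp add: mult.commute)

lemma mtrace_similar:
  assumes "similar_mat_wit A B P Q"
  shows "mtrace A = mtrace B"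
proof -
  obtain n where A: "A \<in> carrier_mat n n" using assms
    unfolding similar_mat_wit_def Let_def by blast
  note d = similar_mat_witD2[OF A assms]
  have "mtrace A = mtrace (P * (B * Q))" using d by simp
  also have "\<dots> = mtrace ((B * Q) * P)"
    by (rule mtrace_mult_commute) (use d in auto)
  also have "(B * Q) * P = B" using d by simp
  finally show ?thesis .
qed

lemma upper_triangular_mult_diag:
  fixes A B :: "'a :: comm_ring_1 mat"
  assumes A: "A \<in> carrier_mat n n" and B: "B \<in> carrier_mat n n"
    and "upper_triangular A" "upper_triangular B"
  shows "upper_triangular (A * B)"
    and "i < n \<Longrightarrow> (A * B) $$ (i,i) = A $$ (i,i) * B $$ (i,i)"
proof -
  have uA: "A $$ (i,j) = 0" if "j < i" "i < n" for i j
    using assms(3) that A by auto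
  have uB: "B $$ (i,j) = 0" if "j < i" "i < n" for i j
    using assms(4) that B by auto
  have AB: "(A * B) $$ (i,j) = (\<Sum>k<n. A $$ (i,k) * B $$ (k,j))" if "i < n" "j < n" for i j
    using A B that by (simp add: scalar_prod_def atLeast0LessThan)
  show "upper_triangular (A * B)"
  proof (rule upper_triangularI)
    fix i j assume ij: "j < i" "i < dim_row (A * B)"
    then have "i < n" using A by simp
    with ij have "(A * B) $$ (i,j) = (\<Sum>k<n. A $$ (i,k) * B $$ (k,j))" by (simp add: AB)
    also have "\<dots> = 0"
    proof (rule sum.neutral, rule ballI)
      fix k assume k: "k \<in> {..<n}"
      show "A $$ (i,k) * B $$ (k,j) = 0"
        using uA[of k i] uB[of j k] \<open>i < n\<close> ij k by (cases "k < i") auto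
    qed
    finally show "(A * B) $$ (i,j) = 0" .
  qed
  show "(A * B) $$ (i,i) = A $$ (i,i) * B $$ (i,i)" if "i < n"
  proof -
    have "(A * B) $$ (i,i) = (\<Sum>k<n. A $$ (i,k) * B $$ (k,i))" using that by (simp add: AB)
    also have "\<dots> = (\<Sum>k<n. if k = i then A $$ (i,i) * B $$ (i,i) else 0)"
    proof (rule sum.cong[OF refl])
      fix k assume k: "k \<in> {..<n}"
      show "A $$ (i,k) * B $$ (k,i) = (if k = i then A $$ (i,i) * B $$ (i,i) else 0)"
        using uA[of k i] uB[of i k] that k by (cases k i rule: linorder_cases) auto
    qed
    also have "\<dots> = A $$ (i,i) * B $$ (i,i)" using that by simp
    finally show ?thesis .
  qed
qed

lemma upper_triangular_pow:
  fixes A :: "'a :: comm_ring_1 mat"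
  assumes A: "A \<in> carrier_mat n n" and u: "upper_triangular A"
  shows "upper_triangular (A ^\<^sub>m k) \<and> (\<forall>i<n. (A ^\<^sub>m k) $$ (i,i) = (A $$ (i,i)) ^ k)"
proof (induction k)
  case 0
  show ?case using A by simp
next
  case (Suc k)
  have Ak: "A ^\<^sub>m k \<in> carrier_mat n n" using A by simp
  show ?case using upper_triangular_mult_diag[OF Ak A _ u] Suc by auto
qed

text \<open>Schur decomposition makes \<open>A\<close> similar to an upper triangular matrix with
  diagonal \<open>es\<close>. The diagonal of its \<open>k\<close>-th power consists of
  \<open>k\<close>-th powers, and similarity preserves the trace.\<close>

lemma mtrace_pow_complex:
  fixes A :: "complex mat"
  assumes A: "A \<in> carrier_mat n n" and es: "char_poly A = (\<Prod>a\<leftarrow>es. [:- a, 1:])"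
  shows "mtrace (A ^\<^sub>m k) = (\<Sum>e\<leftarrow>es. e ^ k)"
proof -
  obtain B P Q where s: "schur_decomposition A es = (B, P, Q)" by (metis prod_cases3)
  from schur_decomposition[OF A es s]
  have w: "similar_mat_wit A B P Q" and u: "upper_triangular B" and d: "diag_mat B = es" by auto
  have B: "B \<in> carrier_mat n n" using similar_mat_witD2[OF A w] by simp
  have "mtrace (A ^\<^sub>m k) = mtrace (B ^\<^sub>m k)"
    by (rule mtrace_similar[OF similar_mat_wit_pow[OF w]])
  also have "\<dots> = (\<Sum>i<n. B $$ (i,i) ^ k)"
    using upper_triangular_pow[OF B u] B by (simp add: mtrace_def)
  also have "\<dots> = (\<Sum>e\<leftarrow>es. e ^ k)"
    using B by (simp add: d[symmetric] diag_mat_def interv_sum_list_conv_sum_set_nat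
        atLeast0LessThan o_def)
  finally show ?thesis .
qed

lemma mtrace_map_of_real: "mtrace (map_mat complex_of_real A) = complex_of_real (mtrace A)"
  if "A \<in> carrier_mat n n"
  using that by (simp add: mtrace_def)

text \<open>A real characteristic polynomial need not split, so both matrices are embedded into the
  complex ones and the equality of traces is pulled back by injectivity.\<close>

lemma cospectral_mtrace_pow:
  fixes A B :: "real mat"
  assumes A: "A \<in> carrier_mat n n" and B: "B \<in> carrier_mat n n" and eq: "char_poly A = char_poly B"
  shows "mtrace (A ^\<^sub>m k) = mtrace (B ^\<^sub>m k)"
proof -
  let ?c = "map_mat complex_of_real"
  have cA: "?c A \<in> carrier_mat n n" and cB: "?c B \<in> carrier_mat n n" using A B by auto
  obtain es where es: "char_poly (?c A) = (\<Prod>a\<leftarrow>es. [:- a, 1:])"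
    using char_poly_factorized[OF cA] by blast
  have e: "char_poly (?c B) = char_poly (?c A)"
    using of_real_hom.char_poly_hom[OF A] of_real_hom.char_poly_hom[OF B] eq by metis
  have "complex_of_real (mtrace (A ^\<^sub>m k)) = mtrace (?c A ^\<^sub>m k)"
    by (metis mtrace_map_of_real of_real_hom.mat_hom_pow A pow_carrier_mat)
  also have "\<dots> = mtrace (?c B ^\<^sub>m k)"
    using mtrace_pow_complex[OF cA es] mtrace_pow_complex[OF cB] es e by metis
  also have "\<dots> = complex_of_real (mtrace (B ^\<^sub>m k))"
    by (metis mtrace_map_of_real of_real_hom.mat_hom_pow B pow_carrier_mat)
  finally show ?thesis by simp
qed

text \<open>A monic complex polynomial is the product of its linear factors, so the multiset of
  roots returns it. The order of the matrix is the number of roots, which is why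
  \<open>m = n\<close> is a conclusion.\<close>

lemma cospectral_imp_char_poly_eq:
  fixes A B :: "real mat"
  assumes A: "A \<in> carrier_mat m m" and B: "B \<in> carrier_mat n n"
    and eq: "spectrum_mset A = spectrum_mset B"
  shows "m = n" and "char_poly A = char_poly B"
proof -
  let ?h = "map_poly complex_of_real"
  have dA: "Polynomial.degree (?h (char_poly A)) = m" "lead_coeff (?h (char_poly A)) = 1"
    using degree_monic_char_poly[OF A] by auto
  have dB: "Polynomial.degree (?h (char_poly B)) = n" "lead_coeff (?h (char_poly B)) = 1"
    using degree_monic_char_poly[OF B] by auto
  show "m = n" using eq dA dB by (metis spectrum_mset_def size_proots_complex)
  have "?h (char_poly A) = ?h (char_poly B)"
    using eq dA dB complex_poly_decompose_multiset[of "?h (char_poly A)"]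
      complex_poly_decompose_multiset[of "?h (char_poly B)"]
    by (simp add: spectrum_mset_def)
  then show "char_poly A = char_poly B"
    by (metis (no_types, lifting) poly_eqI coeff_map_poly of_real_0 of_real_eq_iff)
qed

section \<open>Scalar shifts and rank-one perturbations\<close>

lemma poly_char_poly_shift:
  fixes A :: "'a :: field mat"
  assumes A: "A \<in> carrier_mat n n"
  shows "poly (char_poly (A + c \<cdot>\<^sub>m 1\<^sub>m n)) x = poly (char_poly A) (x - c)"
proof -
  have A': "A + c \<cdot>\<^sub>m 1\<^sub>m n \<in> carrier_mat n n" using A by simp
  have "char_matrix (A + c \<cdot>\<^sub>m 1\<^sub>m n) x = char_matrix A (x - c)"
    using A by (auto simp: char_matrix_def algebra_simps)
  then show ?thesis by (simp add: char_poly_matrix[OF A] char_poly_matrix[OF A'])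
qed

lemma char_poly_shift_eq:
  fixes A B :: "real mat"
  assumes "A \<in> carrier_mat n n" "B \<in> carrier_mat n n" "char_poly A = char_poly B"
  shows "char_poly (A + c \<cdot>\<^sub>m 1\<^sub>m n) = char_poly (B + c \<cdot>\<^sub>m 1\<^sub>m n)"
proof -
  have "poly (char_poly (A + c \<cdot>\<^sub>m 1\<^sub>m n)) = poly (char_poly (B + c \<cdot>\<^sub>m 1\<^sub>m n))"
    by (rule ext) (simp add: poly_char_poly_shift assms)
  then show ?thesis by (simp add: poly_eq_poly_eq_iff)
qed

text \<open>Sylvester's determinant identity: the block matrix \<open>?F\<close> factors both as
  \<open>?L * ?R\<close> and as \<open>?S * ?L\<close>, where the factors are block triangular and
  \<open>?L\<close> has determinant 1.\<close>

lemma det_one_minus_mult_commute: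
  fixes U V :: "'a :: idom mat"
  assumes U: "U \<in> carrier_mat n m" and V: "V \<in> carrier_mat m n"
  shows "det (1\<^sub>m n - U * V) = det (1\<^sub>m m - V * U)"
proof -
  have UV: "1\<^sub>m n - U * V \<in> carrier_mat n n" and VU: "1\<^sub>m m - V * U \<in> carrier_mat m m"
    using U V by auto
  let ?F = "four_block_mat (1\<^sub>m m) V U (1\<^sub>m n)"
  let ?L = "four_block_mat (1\<^sub>m m) (0\<^sub>m m n) U (1\<^sub>m n)"
  let ?R = "four_block_mat (1\<^sub>m m) V (0\<^sub>m n m) (1\<^sub>m n - U * V)"
  let ?S = "four_block_mat (1\<^sub>m m - V * U) V (0\<^sub>m n m) (1\<^sub>m n)"
  have c: "?L \<in> carrier_mat (m + n) (m + n)" "?R \<in> carrier_mat (m + n) (m + n)"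
    "?S \<in> carrier_mat (m + n) (m + n)"
    using UV VU by auto
  have dL: "det ?L = 1"
    using det_four_block_mat_upper_right_zero[OF _ refl U, of "1\<^sub>m m" "1\<^sub>m n"] by simp
  have dR: "det ?R = det (1\<^sub>m n - U * V)"
    using det_four_block_mat_lower_left_zero[OF _ V refl UV, of "1\<^sub>m m"] by simp
  have dS: "det ?S = det (1\<^sub>m m - V * U)"
    using det_four_block_mat_lower_left_zero[OF VU V refl, of "1\<^sub>m n"] by simp
  have "?L * ?R = ?F"
    using U V UV by (subst mult_four_block_mat[of _ m m _ n _ n _ _ m _ n])
      (auto simp: minus_add_uminus_mat[symmetric] intro!: arg_cong2[where f="four_block_mat _ _"])
  moreover have "?S * ?L = ?F"
    using U V VU by (subst mult_four_block_mat[of _ m m _ n _ n _ _ m _ n])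
      (auto intro!: arg_cong2[where f="four_block_mat _ _"])
  ultimately have "det ?L * det ?R = det ?S * det ?L"
    using det_mult[OF c(1,2)] det_mult[OF c(3,1)] by simp
  then show ?thesis by (simp add: dL dR dS)
qed

definition outer :: "'a :: comm_ring_1 vec \<Rightarrow> 'a mat" where
  "outer v = mat (dim_vec v) (dim_vec v) (\<lambda>(i,j). v $ i * v $ j)"

lemma outer_carrier [simp]: "v \<in> carrier_vec n \<Longrightarrow> outer v \<in> carrier_mat n n"
  by (auto simp: outer_def)

lemma outer_mult_vec:
  assumes "v \<in> carrier_vec n" "w \<in> carrier_vec n"
  shows "outer v *\<^sub>v w = (v \<bullet> w) \<cdot>\<^sub>v v"
  using assms by (auto simp: outer_def scalar_prod_def sum_distrib_left ac_simps
      intro!: eq_vecI sum.cong)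

lemma mult_outer:
  assumes "A \<in> carrier_mat n n" "v \<in> carrier_vec n" "A *\<^sub>v v = k \<cdot>\<^sub>v v"
  shows "A * outer v = k \<cdot>\<^sub>m outer v"
proof (rule eq_matI)
  fix i j assume ij: "i < dim_row (k \<cdot>\<^sub>m outer v)" "j < dim_col (k \<cdot>\<^sub>m outer v)"
  then have i: "i < n" "j < n" using assms by (auto simp: outer_def)
  have "(A * outer v) $$ (i,j) = (A *\<^sub>v v) $ i * v $ j"
    using i assms(1,2) by (auto simp: outer_def scalar_prod_def sum_distrib_left ac_simps
      intro!: sum.cong)
  then show "(A * outer v) $$ (i,j) = (k \<cdot>\<^sub>m outer v) $$ (i,j)"
    using i assms by (simp add: outer_def)
qed (use assms in \<open>auto simp: outer_def\<close>)

text \<open>The outer square is a column times a row, so Sylvester's identity reduces the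
  determinant to a 1 by 1 one.\<close>

lemma det_one_minus_outer:
  fixes v :: "'a :: idom vec"
  assumes v: "v \<in> carrier_vec n"
  shows "det (1\<^sub>m n - c \<cdot>\<^sub>m outer v) = 1 - c * (v \<bullet> v)"
proof -
  let ?U = "mat n 1 (\<lambda>(i,_). c * v $ i)" and ?V = "mat 1 n (\<lambda>(_,j). v $ j)"
  have "c \<cdot>\<^sub>m outer v = ?U * ?V"
    using v by (auto simp: outer_def scalar_prod_def intro!: eq_matI)
  moreover have "det (1\<^sub>m 1 - ?V * ?U) = 1 - c * (v \<bullet> v)"
    using v by (subst det_single) (auto simp: scalar_prod_def sum_distrib_left ac_simps intro!: sum.cong)
  ultimately show ?thesis
    using det_one_minus_mult_commute[of ?U n 1 ?V] by simp
qed

lemma smult_mat_vec_one: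
  fixes v :: "'a :: comm_ring_1 vec"
  assumes "v \<in> carrier_vec n"
  shows "(x \<cdot>\<^sub>m 1\<^sub>m n) *\<^sub>v v = x \<cdot>\<^sub>v v"
proof (rule eq_vecI)
  fix i assume "i < dim_vec (x \<cdot>\<^sub>v v)"
  then have i: "i < n" using assms by simp
  have "((x \<cdot>\<^sub>m 1\<^sub>m n) *\<^sub>v v) $ i = (\<Sum>j<n. x * (if j = i then 1 else 0) * v $ j)"
    using assms i by (auto simp: scalar_prod_def atLeast0LessThan intro!: sum.cong)
  also have "\<dots> = (\<Sum>j<n. if j = i then x * v $ i else 0)" by (rule sum.cong) auto
  finally show "((x \<cdot>\<^sub>m 1\<^sub>m n) *\<^sub>v v) $ i = (x \<cdot>\<^sub>v v) $ i" using i assms by simp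
qed (use assms in auto)

text \<open>For \<open>x > k\<close> the eigenvector equation gives
  \<open>x 1 - A - outer v = (x 1 - A) (1 - outer v / (x - k))\<close>, and the second factor has
  determinant \<open>1 - 1 / (x - k)\<close>. Polynomials that agree on a half-line are
  equal.\<close>

lemma char_poly_add_outer:
  fixes A :: "real mat"
  assumes A: "A \<in> carrier_mat n n" and v: "v \<in> carrier_vec n"
    and ev: "A *\<^sub>v v = k \<cdot>\<^sub>v v" and vv: "v \<bullet> v = 1"
  shows "char_poly (A + outer v) * [:-k, 1:] = char_poly A * [:-k - 1, 1:]"
proof (rule ccontr)
  let ?p = "char_poly (A + outer v) * [:-k, 1:] - char_poly A * [:-k - 1, 1:]"
  assume "\<not> ?thesis"
  then have "?p \<noteq> 0" by simp
  then have "finite {x. poly ?p x = 0}" by (rule poly_roots_finite)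
  moreover have "{k<..} \<subseteq> {x. poly ?p x = 0}"
  proof safe
    fix x assume x: "x > k"
    let ?c = "inverse (x - k)"
    let ?M = "- (char_matrix A x)"
    have AO: "A + outer v \<in> carrier_mat n n" and O: "outer v \<in> carrier_mat n n"
      and M: "?M \<in> carrier_mat n n"
      using A v by auto
    have "?M *\<^sub>v v = (x - k) \<cdot>\<^sub>v v"
    proof -
      have "?M = x \<cdot>\<^sub>m 1\<^sub>m n - A" using A by (auto simp: char_matrix_def)
      then have "?M *\<^sub>v v = x \<cdot>\<^sub>v v - A *\<^sub>v v"
        using A v smult_mat_vec_one[OF v, of x]
        by (simp add: minus_mult_distrib_mat_vec[of _ n n])
      then show ?thesis using v by (auto simp: ev algebra_simps)
    qed
    from mult_outer[OF M v this]
    have "?M * (?c \<cdot>\<^sub>m outer v) = outer v"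
      using M O x by (auto simp: mult_smult_distrib)
    then have "?M * (1\<^sub>m n - ?c \<cdot>\<^sub>m outer v) = ?M - outer v"
      using M O by (subst mult_minus_distrib_mat) auto
    also have "\<dots> = - (char_matrix (A + outer v) x)"
      using A O by (auto simp: char_matrix_def)
    finally have "det (- (char_matrix (A + outer v) x)) = det ?M * (1 - ?c)"
      using det_mult[OF M, of "1\<^sub>m n - ?c \<cdot>\<^sub>m outer v"] O det_one_minus_outer[OF v, of ?c] vv
      by (metis minus_carrier_mat mult.right_neutral smult_carrier_mat)
    then have "poly (char_poly (A + outer v)) x = poly (char_poly A) x * (1 - ?c)"
      by (simp only: char_poly_matrix[OF A] char_poly_matrix[OF AO])
    then show "poly ?p x = 0" using x by (simp add: field_simps)
  qed
  ultimately show False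
    using infinite_Ioi finite_subset by blast
qed

text \<open>Adding the outer square of a unit eigenvector moves one root \<open>k\<close> of the characteristic polynomial to
  \<open>k + 1\<close>; a second eigenvector for \<open>k\<close> exists iff \<open>k\<close> is still a root afterwards.\<close>

lemma cospectral_two_eigenvectors:
  fixes A B :: "real mat"
  assumes A: "A \<in> carrier_mat n n" and B: "B \<in> carrier_mat n n"
    and sym: "transpose_mat B = B" and eq: "char_poly A = char_poly B"
    and v: "v \<in> carrier_vec n" "A *\<^sub>v v = k \<cdot>\<^sub>v v"
    and w: "w \<in> carrier_vec n" "A *\<^sub>v w = k \<cdot>\<^sub>v w"
    and ind: "v \<noteq> 0\<^sub>v n" "\<And>c. w \<noteq> c \<cdot>\<^sub>v v"
  obtains u z where "u \<in> carrier_vec n" "B *\<^sub>v u = k \<cdot>\<^sub>v u" "u \<noteq> 0\<^sub>v n"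
    "z \<in> carrier_vec n" "B *\<^sub>v z = k \<cdot>\<^sub>v z" "z \<noteq> 0\<^sub>v n" "u \<bullet> z = 0"
proof -
  have unit: "\<exists>x'. x' \<in> carrier_vec n \<and> M *\<^sub>v x' = k \<cdot>\<^sub>v x' \<and> x' \<bullet> x' = 1 \<and> (\<exists>c. c \<noteq> 0 \<and> x' = c \<cdot>\<^sub>v x)"
    if "M \<in> carrier_mat n n" "x \<in> carrier_vec n" "M *\<^sub>v x = k \<cdot>\<^sub>v x" "x \<noteq> 0\<^sub>v n"
    for M :: "real mat" and x
  proof -
    have "x \<bullet> x > 0"
      using that(2,4) conjugate_square_greater_0_vec[of x n] by simp
    then have "sqrt (x \<bullet> x) * sqrt (x \<bullet> x) = x \<bullet> x" "sqrt (x \<bullet> x) > 0" by auto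
    then show ?thesis
      using that by (intro exI[of _ "inverse (sqrt (x \<bullet> x)) \<cdot>\<^sub>v x"])
        (auto simp: mult_mat_vec smult_smult_assoc field_simps intro!: exI[of _ "inverse (sqrt (x \<bullet> x))"])
  qed
  obtain v' c where v': "v' \<in> carrier_vec n" "A *\<^sub>v v' = k \<cdot>\<^sub>v v'" "v' \<bullet> v' = 1" "c \<noteq> 0" "v' = c \<cdot>\<^sub>v v"
    using unit[OF A v ind(1)] by blast
  \<comment> \<open>One Gram-Schmidt step: \<open>w'\<close> is still in the eigenspace of
    \<open>k\<close>, is orthogonal to \<open>v'\<close>, and is nonzero by independence.\<close>
  define w' where "w' = w - (v' \<bullet> w) \<cdot>\<^sub>v v'"
  have w': "w' \<in> carrier_vec n" using w v' by (simp add: w'_def)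
  have Aw': "A *\<^sub>v w' = k \<cdot>\<^sub>v w'"
    using A w v' by (auto simp: w'_def mult_minus_distrib_mat_vec mult_mat_vec algebra_simps)
  have vw': "v' \<bullet> w' = 0"
    using w v' by (simp add: w'_def scalar_prod_minus_distrib)
  have nz: "w' \<noteq> 0\<^sub>v n"
  proof
    assume z: "w' = 0\<^sub>v n"
    have "w = ((v' \<bullet> w) * c) \<cdot>\<^sub>v v"
    proof (rule eq_vecI)
      fix i assume "i < dim_vec (((v' \<bullet> w) * c) \<cdot>\<^sub>v v)"
      then have i: "i < n" using v by simp
      have "w' $ i = 0" using z i by simp
      then show "w $ i = (((v' \<bullet> w) * c) \<cdot>\<^sub>v v) $ i"
        using i w v v' unfolding w'_def by simp
    qed (use w v in auto)
    then show False using ind(2) by blast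
  qed
  have AO: "A + outer v' \<in> carrier_mat n n" using A v' by simp
  \<comment> \<open>Orthogonality to \<open>v'\<close> means that \<open>outer v'\<close>
    annihilates \<open>w'\<close>, so \<open>k\<close> is still an eigenvalue after the
    perturbation.\<close>
  have "(A + outer v') *\<^sub>v w' = k \<cdot>\<^sub>v w'"
    using A v'(1) w' Aw' vw' by (auto simp: add_mult_distrib_mat_vec[of _ n n] outer_mult_vec)
  then have rootA: "poly (char_poly (A + outer v')) k = 0"
    using nz w' AO v'(1) eigenvalue_root_char_poly[OF AO, of k]
    unfolding eigenvalue_def eigenvector_def by (metis carrier_matD(1))
  have "eigenvalue A k" unfolding eigenvalue_def eigenvector_def using A v ind(1) by auto
  then have "eigenvalue B k"
    by (simp add: eigenvalue_root_char_poly[OF A] eigenvalue_root_char_poly[OF B] eq)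
  then obtain u0 where u0: "u0 \<in> carrier_vec n" "B *\<^sub>v u0 = k \<cdot>\<^sub>v u0" "u0 \<noteq> 0\<^sub>v n"
    using B unfolding eigenvalue_def eigenvector_def by auto
  obtain u where u: "u \<in> carrier_vec n" "B *\<^sub>v u = k \<cdot>\<^sub>v u" "u \<bullet> u = 1"
    using unit[OF B u0] by blast
  have BO: "B + outer u \<in> carrier_mat n n" using B u by simp
  have "char_poly (B + outer u) * [:-k, 1:] = char_poly (A + outer v') * [:-k, 1:]"
    by (simp only: char_poly_add_outer[OF B u] char_poly_add_outer[OF A v'(1-3)] eq)
  then have "char_poly (B + outer u) = char_poly (A + outer v')"
    by (metis mult_right_cancel pCons_eq_0_iff one_neq_zero)
  then have "eigenvalue (B + outer u) k"
    using rootA by (simp add: eigenvalue_root_char_poly[OF BO])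
  then obtain z where z: "z \<in> carrier_vec n" "(B + outer u) *\<^sub>v z = k \<cdot>\<^sub>v z" "z \<noteq> 0\<^sub>v n"
    using BO B unfolding eigenvalue_def eigenvector_def by auto
  have e: "B *\<^sub>v z + (u \<bullet> z) \<cdot>\<^sub>v u = k \<cdot>\<^sub>v z"
    using z u B by (simp add: add_mult_distrib_mat_vec[of _ n n] outer_mult_vec)
  have Bz: "B *\<^sub>v z \<in> carrier_vec n" using B z by simp
  \<comment> \<open>Symmetry of \<open>B\<close> turns the product of the equation \<open>e\<close>
    with \<open>u\<close> into \<open>k c + c = k c\<close> for \<open>c = u \<bullet> z\<close>.
    Hence \<open>c = 0\<close>, and \<open>z\<close> is an eigenvector of \<open>B\<close>
    itself.\<close>
  have "u \<bullet> (B *\<^sub>v z) = (transpose_mat B *\<^sub>v u) \<bullet> z"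
    using B u z by (metis transpose_vec_mult_scalar)
  also have "\<dots> = k * (u \<bullet> z)" using sym u z by simp
  finally have s: "u \<bullet> (B *\<^sub>v z) = k * (u \<bullet> z)" .
  have "u \<bullet> (B *\<^sub>v z + (u \<bullet> z) \<cdot>\<^sub>v u) = u \<bullet> (B *\<^sub>v z) + u \<bullet> z"
    using u z Bz by (subst scalar_prod_add_distrib[of _ n]) auto
  then have uz: "u \<bullet> z = 0" using e s u z by simp
  have "0 \<cdot>\<^sub>v u = 0\<^sub>v n" using u by auto
  then have "B *\<^sub>v z = k \<cdot>\<^sub>v z" using e Bz by (simp add: uz)
  moreover have "u \<noteq> 0\<^sub>v n" using u by auto
  ultimately show thesis using that u z uz by blast
qed

subsection \<open>Power traces and degrees\<close>

definition adj :: "(nat \<Rightarrow> nat \<Rightarrow> bool) \<Rightarrow> nat \<Rightarrow> nat \<Rightarrow> real" where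
  "adj E i j = of_bool (E i j)"

lemma real_degree: "real (degree n E i) = (\<Sum>j<n. adj E i j)"
proof -
  have "(\<Sum>j<n. adj E i j) = real (card {j \<in> {..<n}. E i j})"
    by (simp add: adj_def Int_def)
  then show ?thesis by (simp add: degree_def atLeast0LessThan)
qed

lemma adj_self: "simple_graph n E \<Longrightarrow> adj E i i = 0"
  by (auto simp: adj_def simple_graph_def)

lemma simple_graph_compl: "simple_graph n E \<Longrightarrow> simple_graph n (compl_graph n E)"
  by (auto simp: simple_graph_def compl_graph_def)

lemma compl_compl: "simple_graph n E \<Longrightarrow> compl_graph n (compl_graph n E) = E"
  by (auto simp: simple_graph_def compl_graph_def fun_eq_iff)

lemma degree_compl:
  assumes G: "simple_graph n E" and i: "i < n"
  shows "real (degree n (compl_graph n E) i) = real n - 1 - real (degree n E i)"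
proof -
  have "(\<Sum>j<n. adj (compl_graph n E) i j) = (\<Sum>j<n. 1 - adj E i j - (if j = i then 1 else 0 :: real))"
    using G i by (intro sum.cong) (auto simp: adj_def simple_graph_def compl_graph_def)
  also have "\<dots> = real n - 1 - (\<Sum>j<n. adj E i j)"
    using i by (simp add: sum_subtractf)
  finally show ?thesis by (simp only: real_degree)
qed

definition shifted_compl_mat :: "real \<Rightarrow> nat \<Rightarrow> (nat \<Rightarrow> nat \<Rightarrow> bool) \<Rightarrow> real mat" where
  "shifted_compl_mat \<alpha> n E = mat n n (\<lambda>(i,j). (1 - \<alpha>) * (1 - adj E i j)
     - (if i = j then \<alpha> * real (degree n E i) else 0))"

lemma shifted_compl_mat_carrier [simp]: "shifted_compl_mat \<alpha> n E \<in> carrier_mat n n"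
  by (simp add: shifted_compl_mat_def)

lemma A_alpha_carrier [simp]: "A_alpha \<alpha> n E \<in> carrier_mat n n"
  by (simp add: A_alpha_def deg_matrix_def adj_matrix_def)

text \<open>Complementation replaces \<open>A\<close> by \<open>J - 1 - A\<close> and each degree
  \<open>d\<close> by \<open>n - 1 - d\<close>; the terms that do not depend on the graph combine
  into \<open>(1 - \<alpha>) J\<close> and a multiple of the identity.\<close>

lemma A_alpha_compl_shift:
  assumes "simple_graph n E"
  shows "A_alpha \<alpha> n (compl_graph n E) + ((1 - \<alpha>) - \<alpha> * (real n - 1)) \<cdot>\<^sub>m 1\<^sub>m n = shifted_compl_mat \<alpha> n E"
  using assms by (auto simp: A_alpha_def deg_matrix_def adj_matrix_def shifted_compl_mat_def
      degree_compl adj_def algebra_simps compl_graph_def simple_graph_def intro!: eq_matI)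

lemma cospectral_shifted_compl_mat:
  assumes "simple_graph n E" "simple_graph n E'"
    and "char_poly (A_alpha \<alpha> n (compl_graph n E)) = char_poly (A_alpha \<alpha> n (compl_graph n E'))"
  shows "char_poly (shifted_compl_mat \<alpha> n E) = char_poly (shifted_compl_mat \<alpha> n E')"
  using char_poly_shift_eq[OF A_alpha_carrier A_alpha_carrier assms(3)] A_alpha_compl_shift assms
  by metis

text \<open>The diagonal entries are \<open>(1 - \<alpha>) - \<alpha> d\<close>. The trace therefore
  contains the degree sum with coefficient \<open>- \<alpha>\<close>, and the trace of the square
  contains the sum of squares with coefficient \<open>\<alpha>^2\<close>; both coefficients vanish
  at \<open>\<alpha> = 0\<close>.\<close>

lemma cospectral_degrees_pos:
  assumes G: "simple_graph n E" and G': "simple_graph n E'" and a: "0 < \<alpha>"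
    and eq: "char_poly (shifted_compl_mat \<alpha> n E) = char_poly (shifted_compl_mat \<alpha> n E')"
  shows "(\<Sum>i<n. real (degree n E i)) = (\<Sum>i<n. real (degree n E' i))"
    and "(\<Sum>i<n. (real (degree n E i))\<^sup>2) = (\<Sum>i<n. (real (degree n E' i))\<^sup>2)"
proof -
  have t1: "mtrace (shifted_compl_mat \<alpha> n E) = real n * (1 - \<alpha>) - \<alpha> * (\<Sum>i<n. real (degree n E i))"
    if "simple_graph n E" for E
    using that by (auto simp: mtrace_def shifted_compl_mat_def adj_self sum_subtractf sum_distrib_left)
  have t2: "mtrace (shifted_compl_mat \<alpha> n E * shifted_compl_mat \<alpha> n E)
     = (real n)\<^sup>2 * (1-\<alpha>)\<^sup>2 - ((1-\<alpha>)\<^sup>2 + 2 * \<alpha> * (1 - \<alpha>)) * (\<Sum>i<n. real (degree n E i))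
       + \<alpha>\<^sup>2 * (\<Sum>i<n. (real (degree n E i))\<^sup>2)"
    if G: "simple_graph n E" for E
  proof -
    have "mtrace (shifted_compl_mat \<alpha> n E * shifted_compl_mat \<alpha> n E) =
      (\<Sum>i<n. \<Sum>j<n. (1-\<alpha>)\<^sup>2 - (1-\<alpha>)\<^sup>2 * adj E i j +
         (if j = i then \<alpha>\<^sup>2 * (real (degree n E i))\<^sup>2 - 2 * \<alpha> * (1 - \<alpha>) * real (degree n E i) else 0))"
      unfolding mtrace_mult[OF shifted_compl_mat_carrier shifted_compl_mat_carrier]
      using G by (intro sum.cong) (auto simp: shifted_compl_mat_def adj_def simple_graph_def algebra_simps power2_eq_square)
    also have "\<dots> = (\<Sum>i<n. real n * (1-\<alpha>)\<^sup>2 - (1-\<alpha>)\<^sup>2 * real (degree n E i) +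
        (\<alpha>\<^sup>2 * (real (degree n E i))\<^sup>2 - 2 * \<alpha> * (1 - \<alpha>) * real (degree n E i)))"
      by (intro sum.cong) (simp_all add: sum.distrib sum_subtractf sum_distrib_left[symmetric] real_degree)
    also have "\<dots> = (real n)\<^sup>2 * (1-\<alpha>)\<^sup>2 - ((1-\<alpha>)\<^sup>2 + 2 * \<alpha> * (1 - \<alpha>)) * (\<Sum>i<n. real (degree n E i))
       + \<alpha>\<^sup>2 * (\<Sum>i<n. (real (degree n E i))\<^sup>2)"
      by (simp add: sum.distrib sum_subtractf sum_distrib_left[symmetric] algebra_simps power2_eq_square)
    finally show ?thesis .
  qed
  have pow1: "A ^\<^sub>m 1 = A" and pow2: "A ^\<^sub>m 2 = A * A" if "A \<in> carrier_mat n n" for A :: "real mat"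
    using that by (auto simp: numeral_2_eq_2)
  note tr = cospectral_mtrace_pow[OF shifted_compl_mat_carrier shifted_compl_mat_carrier eq]
  show 1: "(\<Sum>i<n. real (degree n E i)) = (\<Sum>i<n. real (degree n E' i))"
  proof -
    have "real n * (1 - \<alpha>) - \<alpha> * (\<Sum>i<n. real (degree n E i))
        = real n * (1 - \<alpha>) - \<alpha> * (\<Sum>i<n. real (degree n E' i))"
      using tr[of 1] by (simp only: pow1[OF shifted_compl_mat_carrier] t1[OF G] t1[OF G'])
    then have "\<alpha> * (\<Sum>i<n. real (degree n E i)) = \<alpha> * (\<Sum>i<n. real (degree n E' i))" by linarith
    then show ?thesis using a by (metis mult_left_cancel less_irrefl)
  qed
  show "(\<Sum>i<n. (real (degree n E i))\<^sup>2) = (\<Sum>i<n. (real (degree n E' i))\<^sup>2)"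
    using tr[of 2] a by (simp add: pow2[OF shifted_compl_mat_carrier] t2[OF G] t2[OF G'] 1)
qed

section \<open>Closed walks and the first four moments at \<open>\<alpha> = 0\<close>\<close>

text \<open>Entries of the squared adjacency matrix: in a simple graph, the numbers of common
  neighbours, with the degrees on the diagonal.\<close>

definition codeg :: "nat \<Rightarrow> (nat \<Rightarrow> nat \<Rightarrow> bool) \<Rightarrow> nat \<Rightarrow> nat \<Rightarrow> real" where
  "codeg n E i j = (\<Sum>k<n. adj E i k * adj E k j)"

definition deg_sum :: "nat \<Rightarrow> (nat \<Rightarrow> nat \<Rightarrow> bool) \<Rightarrow> real" where
  "deg_sum n E = (\<Sum>i<n. real (degree n E i))"

definition deg_sqsum :: "nat \<Rightarrow> (nat \<Rightarrow> nat \<Rightarrow> bool) \<Rightarrow> real" where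
  "deg_sqsum n E = (\<Sum>i<n. (real (degree n E i))\<^sup>2)"

text \<open>Each triangle is counted 6 times in \<open>triangles\<close> and each 4-cycle 8 times in \<open>quads\<close>.\<close>

definition triangles :: "nat \<Rightarrow> (nat \<Rightarrow> nat \<Rightarrow> bool) \<Rightarrow> real" where
  "triangles n E = (\<Sum>i<n. \<Sum>j<n. codeg n E i j * adj E i j)"

definition quads :: "nat \<Rightarrow> (nat \<Rightarrow> nat \<Rightarrow> bool) \<Rightarrow> real" where
  "quads n E = (\<Sum>i<n. \<Sum>j<n. if i = j then 0 else codeg n E i j * (codeg n E i j - 1))"

text \<open>The quadratic form of the adjacency matrix at the vector \<open>d - 2\<close>. The shift
  by 2 makes it vanish for a path on at least three vertices, whose only vertices of degree other
  than 2 are the two nonadjacent ends.\<close>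

definition excess_form :: "nat \<Rightarrow> (nat \<Rightarrow> nat \<Rightarrow> bool) \<Rightarrow> real" where
  "excess_form n E = (\<Sum>i<n. \<Sum>j<n. adj E i j * ((real (degree n E i) - 2) * (real (degree n E j) - 2)))"

context
  fixes n :: nat and E :: "nat \<Rightarrow> nat \<Rightarrow> bool"
  assumes G: "simple_graph n E"
begin

private abbreviation "d \<equiv> (\<lambda>i. real (degree n E i))"

lemma adj_sym: "adj E j i = adj E i j"
  using G by (auto simp: adj_def simple_graph_def)

lemma sum_adj: "(\<Sum>j<n. adj E i j) = d i"
  by (simp only: real_degree)

lemma sum_adj': "(\<Sum>j<n. adj E j i) = d i"
  by (subst adj_sym) (rule sum_adj)

lemma sum_adj_left: "(\<Sum>i<n. \<Sum>j<n. adj E i j * g i) = (\<Sum>i<n. d i * g i)"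
  by (simp add: sum_distrib_right[symmetric] sum_adj)

lemma sum_adj_right: "(\<Sum>i<n. \<Sum>j<n. adj E i j * g j) = (\<Sum>i<n. d i * g i)"
  by (subst sum.swap) (simp add: sum_distrib_right[symmetric] sum_adj')

lemma codeg_diag: "codeg n E i i = d i"
proof -
  have "codeg n E i i = (\<Sum>k<n. adj E i k)"
    unfolding codeg_def by (intro sum.cong) (use G in \<open>auto simp: adj_def simple_graph_def\<close>)
  then show ?thesis by (simp add: sum_adj)
qed

lemma codeg_sym: "codeg n E j i = codeg n E i j"
  unfolding codeg_def by (intro sum.cong) (use G in \<open>auto simp: adj_def simple_graph_def\<close>)

lemma sum_codeg_right: "(\<Sum>j<n. codeg n E i j * g j) = (\<Sum>k<n. adj E i k * (\<Sum>j<n. adj E k j * g j))"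
  unfolding codeg_def sum_distrib_right sum_distrib_left
  by (subst sum.swap) (simp add: mult.assoc)

lemma sum_codeg: "(\<Sum>i<n. \<Sum>j<n. codeg n E i j) = deg_sqsum n E"
proof -
  have "(\<Sum>i<n. \<Sum>j<n. codeg n E i j) = (\<Sum>i<n. \<Sum>j<n. adj E i j * d j)"
    using sum_codeg_right[where g="\<lambda>_. 1"] by (simp add: sum_adj)
  then show ?thesis by (simp add: sum_adj_right deg_sqsum_def power2_eq_square)
qed

text \<open>Off the diagonal a square \<open>c^2\<close> is split as \<open>c (c - 1) + c\<close>,
  the first part being counted by \<open>quads\<close>; the diagonal, left out of
  \<open>quads\<close>, adds \<open>d^2 - d\<close>.\<close>

lemma sum_codeg_sq: "(\<Sum>i<n. \<Sum>j<n. (codeg n E i j)\<^sup>2) = quads n E + 2 * deg_sqsum n E - deg_sum n E"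
proof -
  have "(codeg n E i j)\<^sup>2 = (if i = j then 0 else codeg n E i j * (codeg n E i j - 1)) + codeg n E i j
      + (if j = i then (d i)\<^sup>2 - d i else 0)" for i j
    by (auto simp: codeg_diag power2_eq_square algebra_simps)
  then have "(\<Sum>i<n. \<Sum>j<n. (codeg n E i j)\<^sup>2) =
     quads n E + (\<Sum>i<n. \<Sum>j<n. codeg n E i j) + (\<Sum>i<n. \<Sum>j<n. if j = i then (d i)\<^sup>2 - d i else 0)"
    by (simp only: quads_def sum.distrib)
  also have "(\<Sum>i<n. \<Sum>j<n. if j = i then (d i)\<^sup>2 - d i else 0) = deg_sqsum n E - deg_sum n E"
    by (simp add: sum_subtractf deg_sqsum_def deg_sum_def)
  finally show ?thesis by (simp add: sum_codeg)
qed

lemma sum_degree_adj: "(\<Sum>i<n. \<Sum>j<n. adj E i j * (d i * d j)) = excess_form n E + 4 * deg_sqsum n E - 4 * deg_sum n E"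
proof -
  have "adj E i j * (d i * d j) = adj E i j * ((d i - 2) * (d j - 2)) + 2 * (adj E i j * d i)
      + 2 * (adj E i j * d j) - 4 * adj E i j" for i j
    by (simp add: algebra_simps)
  then have "(\<Sum>i<n. \<Sum>j<n. adj E i j * (d i * d j)) = excess_form n E
     + 2 * (\<Sum>i<n. \<Sum>j<n. adj E i j * d i) + 2 * (\<Sum>i<n. \<Sum>j<n. adj E i j * d j)
     - 4 * (\<Sum>i<n. \<Sum>j<n. adj E i j)"
    by (simp only: excess_form_def sum.distrib sum_subtractf sum_distrib_left)
  then show ?thesis
    unfolding sum_adj_left sum_adj_right sum_adj
    by (simp add: deg_sqsum_def deg_sum_def power2_eq_square)
qed

private abbreviation "C \<equiv> shifted_compl_mat 0 n E"

lemma C_entry: "i < n \<Longrightarrow> j < n \<Longrightarrow> C $$ (i,j) = 1 - adj E i j"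
  by (simp add: shifted_compl_mat_def)

text \<open>\<open>C\<close> is \<open>J - A\<close>, with square
  \<open>n J - A J - J A + A^2\<close>, and the entries of \<open>A J\<close> and \<open>J A\<close>
  are degrees.\<close>

lemma C_sq_entry:
  assumes "i < n" "j < n"
  shows "(C * C) $$ (i,j) = real n - d i - d j + codeg n E i j"
proof -
  have "(C * C) $$ (i,j) = (\<Sum>k<n. C $$ (i,k) * C $$ (k,j))"
    using assms carrier_matD[OF shifted_compl_mat_carrier[of 0 n E]]
    by (simp add: scalar_prod_def atLeast0LessThan)
  also have "\<dots> = (\<Sum>k<n. 1 - adj E i k - adj E k j + adj E i k * adj E k j)"
    using assms by (intro sum.cong) (auto simp: C_entry algebra_simps)
  also have "\<dots> = real n - d i - d j + codeg n E i j"
    by (simp add: sum.distrib sum_subtractf sum_adj sum_adj' codeg_def)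
  finally show ?thesis .
qed

lemma mtrace_C2: "mtrace (C * C) = (real n)\<^sup>2 - deg_sum n E"
proof -
  have "mtrace (C * C) = (\<Sum>i<n. real n - 2 * d i + d i)"
    using carrier_matD[OF shifted_compl_mat_carrier[of 0 n E]]
    by (simp add: mtrace_def C_sq_entry codeg_diag del: index_mult_mat(1))
  then show ?thesis by (simp add: sum.distrib sum_subtractf deg_sum_def power2_eq_square)
qed

lemma mtrace_C3: "mtrace ((C * C) * C) = (real n)^3 - 3 * real n * deg_sum n E + 3 * deg_sqsum n E - triangles n E"
proof -
  have "mtrace ((C * C) * C) = (\<Sum>i<n. \<Sum>j<n. (real n - d i - d j + codeg n E i j) * (1 - adj E i j))"
    by (subst mtrace_mult[of _ n n])
      (auto simp: C_sq_entry C_entry adj_sym intro!: sum.cong mult_carrier_mat[of _ n n])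
  also have "\<dots> = (\<Sum>i<n. \<Sum>j<n. real n - d i - d j + codeg n E i j - real n * adj E i j + adj E i j * d i
      + adj E i j * d j - codeg n E i j * adj E i j)"
    by (intro sum.cong) (auto simp: algebra_simps)
  also have "\<dots> = (real n)^3 - 2 * real n * deg_sum n E + (\<Sum>i<n. \<Sum>j<n. codeg n E i j)
     - real n * (\<Sum>i<n. \<Sum>j<n. adj E i j) + (\<Sum>i<n. \<Sum>j<n. adj E i j * d i) + (\<Sum>i<n. \<Sum>j<n. adj E i j * d j)
     - triangles n E"
    by (simp add: sum.distrib sum_subtractf right_diff_distrib distrib_left deg_sum_def triangles_def power3_eq_cube
        flip: sum_distrib_left)
  finally show ?thesis
    unfolding sum_codeg sum_adj_left sum_adj_right sum_adj
    by (simp add: deg_sum_def deg_sqsum_def power2_eq_square)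
qed

text \<open>As \<open>C * C\<close> is symmetric, the trace is the sum of its squared entries. The
  bracket with factor 4 is the sum of \<open>d i * d j\<close> over ordered adjacent pairs,
  rewritten by \<open>sum_degree_adj\<close>.\<close>

lemma mtrace_C4: "mtrace ((C * C) * (C * C)) = (real n)^4 - 4 * (real n)\<^sup>2 * deg_sum n E
    + 4 * real n * deg_sqsum n E + 2 * (deg_sum n E)\<^sup>2
    - 4 * (excess_form n E + 4 * deg_sqsum n E - 4 * deg_sum n E)
    + quads n E + 2 * deg_sqsum n E - deg_sum n E"
proof -
  have "mtrace ((C * C) * (C * C)) = (\<Sum>i<n. \<Sum>j<n. (real n - d i - d j + codeg n E i j)\<^sup>2)"
    by (subst mtrace_mult[of _ n n])
      (auto simp: C_sq_entry codeg_sym power2_eq_square intro!: sum.cong mult_carrier_mat[of _ n n])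
  also have "\<dots> = (\<Sum>i<n. \<Sum>j<n. (real n)\<^sup>2 - 2 * real n * d i - 2 * real n * d j + (d i)\<^sup>2 + (d j)\<^sup>2
      + 2 * (d i * d j) + 2 * real n * codeg n E i j - 2 * (d i * codeg n E i j)
      - 2 * (codeg n E i j * d j) + (codeg n E i j)\<^sup>2)"
    by (intro sum.cong) (auto simp: algebra_simps power2_eq_square)
  also have "\<dots> = (real n)^4 - 4 * (real n)\<^sup>2 * deg_sum n E + 2 * real n * deg_sqsum n E
     + 2 * (\<Sum>i<n. \<Sum>j<n. d i * d j) + 2 * real n * (\<Sum>i<n. \<Sum>j<n. codeg n E i j)
     - 2 * (\<Sum>i<n. d i * (\<Sum>j<n. codeg n E i j * 1)) - 2 * (\<Sum>i<n. \<Sum>j<n. codeg n E i j * d j)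
     + (\<Sum>i<n. \<Sum>j<n. (codeg n E i j)\<^sup>2)"
    by (simp add: sum.distrib sum_subtractf right_diff_distrib distrib_left deg_sum_def deg_sqsum_def
        power2_eq_square power4_eq_xxxx flip: sum_distrib_left)
  also have "(\<Sum>i<n. \<Sum>j<n. d i * d j) = (deg_sum n E)\<^sup>2"
    by (simp add: deg_sum_def power2_eq_square sum_product)
  also have "(\<Sum>i<n. d i * (\<Sum>j<n. codeg n E i j * 1)) = (\<Sum>i<n. \<Sum>j<n. adj E i j * (d i * d j))"
    unfolding sum_codeg_right by (simp add: sum_adj sum_distrib_left ac_simps)
  also have "(\<Sum>i<n. \<Sum>j<n. codeg n E i j * d j) = (\<Sum>i<n. \<Sum>j<n. adj E i j * (d i * d j))"
    unfolding sum_codeg_right by (subst sum_adj_right)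
      (simp add: sum_adj sum_distrib_left ac_simps)
  finally show ?thesis
    unfolding sum_codeg sum_codeg_sq sum_degree_adj by (simp add: algebra_simps)
qed

end

text \<open>The traces of orders 2, 3 and 4 in turn, each simplified by the equality of degree sums.
  The coefficient \<open>4 n - 14\<close> collects \<open>4 n - 16 + 2\<close> from
  \<open>mtrace_C4\<close>.\<close>

lemma cospectral_moments:
  assumes G: "simple_graph n E" and G': "simple_graph n E'"
    and eq: "char_poly (shifted_compl_mat 0 n E) = char_poly (shifted_compl_mat 0 n E')"
  shows "deg_sum n E = deg_sum n E'"
    and "3 * deg_sqsum n E - triangles n E = 3 * deg_sqsum n E' - triangles n E'"
    and "(4 * real n - 14) * deg_sqsum n E - 4 * excess_form n E + quads n E
       = (4 * real n - 14) * deg_sqsum n E' - 4 * excess_form n E' + quads n E'"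
proof -
  have pow: "A ^\<^sub>m 2 = A * A" "A ^\<^sub>m 3 = (A * A) * A" "A ^\<^sub>m 4 = (A * A) * (A * A)"
    if "A \<in> carrier_mat n n" for A :: "real mat"
    using that by (auto simp: numeral_2_eq_2 numeral_3_eq_3 numeral_eq_Suc assoc_mult_mat[of _ n n _ n _ n])
  note tr = cospectral_mtrace_pow[OF shifted_compl_mat_carrier shifted_compl_mat_carrier eq]
  note p = pow[OF shifted_compl_mat_carrier]
  show 1: "deg_sum n E = deg_sum n E'"
    using tr[of 2] by (simp add: p mtrace_C2[OF G] mtrace_C2[OF G'])
  show 2: "3 * deg_sqsum n E - triangles n E = 3 * deg_sqsum n E' - triangles n E'"
    using tr[of 3] by (simp add: p mtrace_C3[OF G] mtrace_C3[OF G'] 1)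
  show "(4 * real n - 14) * deg_sqsum n E - 4 * excess_form n E + quads n E
       = (4 * real n - 14) * deg_sqsum n E' - 4 * excess_form n E' + quads n E'"
    using tr[of 4] by (simp add: p mtrace_C4[OF G] mtrace_C4[OF G'] 1 algebra_simps)
qed

text \<open>Here \<open>s\<close>, \<open>l\<close>, \<open>z\<close>, \<open>c\<close> are the numbers of vertices of degree at least 3, equal to 1, equal to 0 and
  at least 2, while \<open>a\<close> and \<open>b\<close> are the sums of \<open>d - 2\<close> and \<open>(d - 2)\<^sup>2\<close> over the vertices of degree at least 3.\<close>

lemma excess_arith:
  fixes n s a b K l z c :: int
  assumes nn: "0 \<le> s" "0 \<le> z" "0 \<le> l" and K: "0 < K"
    and l: "l = a + 2 - 2 * z" and ab: "a + b + 2 * z = K"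
    and sa: "s \<le> a" and as: "a \<le> b" and s1: "s = 1 \<Longrightarrow> b = a\<^sup>2" and s0: "s = 0 \<Longrightarrow> a = 0 \<and> b = 0"
    and main: "(2 * n - 7) * K \<le> 2 * l + 2 * ((s - 1) * b)"
    and n: "l + z + c = n" and c: "3 \<le> c" "s \<le> c" and sn: "3 * s \<le> 2 * n - 2"
  shows False
proof -
  consider "s = 0" | "s = 1" | "s = 2" | "s = 3" | "s \<ge> 4" using nn by linarith
  then show ?thesis
  proof cases
    \<comment> \<open>Here \<open>K = 2 z\<close> and \<open>l = 2 - 2 z\<close>, which leaves
      \<open>z = 1\<close>, \<open>l = 0\<close>, \<open>K = 2\<close>; then \<open>main\<close>
      bounds \<open>n\<close> by 3, but \<open>n\<close> is at least 4.\<close>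
    case 1
    then have "a = 0" "b = 0" using s0 by auto
    then have "z = 1" using K ab l nn by linarith
    then have "l = 0" "K = 2" using ab l \<open>a = 0\<close> \<open>b = 0\<close> by simp_all
    then show False using main n c \<open>b = 0\<close> \<open>z = 1\<close> by simp
  next
    \<comment> \<open>The second term of \<open>main\<close> vanishes. For \<open>a \<ge> 2\<close>
      the equality \<open>b = a^2\<close> makes \<open>K\<close> too large compared with
      \<open>l\<close>; for \<open>a = 1\<close> only \<open>z = 0\<close> and \<open>z = 1\<close>
      remain.\<close>
    case 2
    then have b: "b = a * a" using s1 by (simp add: power2_eq_square)
    have m: "(2 * n - 7) * K \<le> 2 * l" using main 2 by simp
    have nge: "n \<ge> l + 3 + z" using n c by linarith
    have "a = 1"
    proof (rule ccontr)
      assume "a \<noteq> 1"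
      then have a2: "a \<ge> 2" using sa 2 by linarith
      then have "a * a \<ge> 2 * a" by (simp add: mult_right_mono)
      then have K3: "K \<ge> 3 * a + 2 * z" using ab b by linarith
      have "n \<ge> 5 + a - z" using nge l by linarith
      moreover have "2 * z \<le> a + 2" using l nn by linarith
      ultimately have "2 * n - 7 \<ge> 1 + a" by linarith
      moreover have "1 + a > 0" using a2 by linarith
      ultimately have "(1 + a) * K \<le> (2 * n - 7) * K" using K by (simp add: mult_right_mono)
      moreover have "3 * K \<le> (1 + a) * K" using K a2 by (simp add: mult_right_mono)
      ultimately have "3 * K \<le> 2 * l" using m by linarith
      then show False using K3 l a2 nn by linarith
    qed
    then have "b = 1" "K = 2 + 2 * z" "l = 3 - 2 * z" using b ab l by auto
    then have "z = 0 \<or> z = 1" using nn by linarith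
    then show False using m nge \<open>K = 2 + 2 * z\<close> \<open>l = 3 - 2 * z\<close> by auto
  next
    \<comment> \<open>The right side of \<open>main\<close> becomes \<open>2 K + 4 - 8 z\<close>.
      This forces \<open>n \<le> 5\<close>; counting vertices then gives
      \<open>z \<ge> a \<ge> 2\<close>, for which the bound fails.\<close>
    case 3
    then have m: "(2 * n - 7) * K \<le> 2 * K + 4 - 8 * z" using main l ab by simp
    have K4: "K \<ge> 4 + 2 * z" using ab as sa 3 by linarith
    have "n \<le> 5"
    proof (rule ccontr)
      assume "\<not> n \<le> 5"
      then have "5 * K \<le> (2 * n - 7) * K" using K by (intro mult_right_mono) auto
      then show False using m K4 nn by linarith
    qed
    have "z \<ge> a" using \<open>n \<le> 5\<close> n l c by linarith
    then have z2: "z \<ge> 2" using sa 3 by linarith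
    then have "n = 5" using n nn c \<open>n \<le> 5\<close> by linarith
    then show False using m K4 z2 by simp
  next
    \<comment> \<open>Now \<open>sn\<close> yields \<open>2 n - 7 \<ge> 4\<close>, and
      \<open>4 K\<close> exceeds \<open>2 l + 4 b\<close>.\<close>
    case 4
    then have "2 * n - 7 \<ge> 4" using sn by linarith
    then have "4 * K \<le> (2 * n - 7) * K" using K by (intro mult_right_mono) auto
    then show False using main 4 l ab sa nn by simp
  next
    \<comment> \<open>By \<open>sn\<close> the left side of \<open>main\<close> is at least
      \<open>(3 s - 5) K\<close>, whereas the right side grows at most like
      \<open>2 s K\<close>.\<close>
    case 5
    have "(3 * s - 5) * K \<le> (2 * n - 7) * K" using sn K by (intro mult_right_mono) auto
    then have 1: "3 * (s * K) - 5 * K \<le> (2 * n - 7) * K" by (simp add: algebra_simps)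
    have "2 * a \<le> (s - 2) * a" using sa 5 by (intro mult_right_mono) auto
    then have 2: "2 * a \<le> s * a - 2 * a" by (simp add: algebra_simps)
    have 3: "s * z \<ge> 0" using nn by simp
    have 4: "s * K \<ge> 4 * K" using 5 K by (intro mult_right_mono) auto
    have b: "b = K - a - 2 * z" using ab by linarith
    have "(s - 1) * b = s * K - s * a - 2 * (s * z) - K + a + 2 * z" unfolding b by (simp add: algebra_simps)
    then show False using main l 1 2 3 4 sa 5 nn K by linarith
  qed
qed

section \<open>Triangles, 4-cycles and the upper bound for \<open>excess_form\<close>\<close>

lemma codeg_card: "codeg n E i j = real (card {k \<in> {..<n}. E i k \<and> E k j})"
proof -
  have "codeg n E i j = (\<Sum>k<n. of_bool (E i k \<and> E k j))"
    unfolding codeg_def adj_def by (intro sum.cong) auto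
  then show ?thesis by (simp add: Int_def)
qed

lemma quads_nonneg: "quads n E \<ge> 0"
proof -
  have "real m * (real m - 1) \<ge> 0" for m :: nat by (cases m) auto
  then show ?thesis unfolding quads_def codeg_card by (intro sum_nonneg) auto
qed

lemma adj_imp_degree_pos: "simple_graph n E \<Longrightarrow> E i j \<Longrightarrow> degree n E i \<ge> 1 \<and> degree n E j \<ge> 1"
proof -
  assume G: "simple_graph n E" and e: "E i j"
  have "j \<in> {j \<in> {0..<n}. E i j}" "i \<in> {i \<in> {0..<n}. E j i}"
    using G e by (auto simp: simple_graph_def)
  then have "card {j \<in> {0..<n}. E i j} \<noteq> 0" "card {i \<in> {0..<n}. E j i} \<noteq> 0"
    by auto
  then show ?thesis unfolding degree_def by linarith
qed

text \<open>A nonzero summand exhibits a triangle, and each of its vertices has the other two as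
  neighbours.\<close>

lemma triangles_nonzero:
  assumes G: "simple_graph n E" and T: "triangles n E \<noteq> 0"
  shows "3 \<le> card {i \<in> {..<n}. 2 \<le> degree n E i}"
proof -
  obtain i j where ij: "i < n" "j < n" "codeg n E i j * adj E i j \<noteq> 0"
    using T unfolding triangles_def by (metis (no_types, lifting) lessThan_iff sum.neutral)
  then have E: "E i j" and "codeg n E i j \<noteq> 0" by (auto simp: adj_def)
  then have "{k \<in> {..<n}. E i k \<and> E k j} \<noteq> {}" unfolding codeg_card by (metis card.empty of_nat_0)
  then obtain k where k: "k < n" "E i k" "E k j" by auto
  have two: "2 \<le> degree n E x" if "E x y" "E x w" "y \<noteq> w" for x y w
  proof -
    have "{y, w} \<subseteq> {j \<in> {0..<n}. E x j}" using that G by (auto simp: simple_graph_def)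
    then have "card {y, w} \<le> degree n E x" unfolding degree_def by (intro card_mono) auto
    then show ?thesis using that by simp
  qed
  have sym: "E j i" "E k i" "E j k" and ne: "i \<noteq> j" "i \<noteq> k" "j \<noteq> k"
    using G E k by (auto simp: simple_graph_def)
  have "{i, j, k} \<subseteq> {i \<in> {..<n}. 2 \<le> degree n E i}"
    using two[of i j k] two[of j i k] two[of k i j] E k sym ne ij by auto
  then have "card {i, j, k} \<le> card {i \<in> {..<n}. 2 \<le> degree n E i}" by (intro card_mono) auto
  then show ?thesis using ne by simp
qed

text \<open>An adjacent pair containing a leaf contributes at most 1, and a positive amount only if
  both ends are leaves; this is charged to its first vertex. A pair inside \<open>S\<close> is split
  by the inequality of arithmetic and geometric means. A vertex of \<open>S\<close> has at most
  \<open>card S - 1\<close> neighbours in \<open>S\<close> and pays half its square twice for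
  each.\<close>

lemma excess_form_le:
  assumes G: "simple_graph n E"
  defines "S \<equiv> {i \<in> {..<n}. 3 \<le> degree n E i}"
  shows "excess_form n E \<le> real (card {i \<in> {..<n}. degree n E i = 1})
     + (real (card S) - 1) * (\<Sum>i\<in>S. (real (degree n E i) - 2)\<^sup>2)"
proof -
  let ?d = "\<lambda>i. real (degree n E i)"
  let ?l = "\<lambda>i. of_bool (degree n E i = 1) :: real" and ?s = "\<lambda>i. of_bool (3 \<le> degree n E i) :: real"
  let ?h = "\<lambda>i j. adj E i j * (?s i * ?s j * ((?d i - 2)\<^sup>2 / 2))"
  have pt: "adj E i j * ((?d i - 2) * (?d j - 2)) \<le> adj E i j * ?l i + (?h i j + ?h j i)" for i j
  proof (cases "E i j")
    case True
    then have 1: "1 \<le> ?d i" "1 \<le> ?d j" using adj_imp_degree_pos[OF G True] by auto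
    have sym: "E j i" using G True by (auto simp: simple_graph_def)
    have amgm: "(?d i - 2) * (?d j - 2) \<le> (?d i - 2)\<^sup>2 / 2 + (?d j - 2)\<^sup>2 / 2"
      using sum_squares_bound[of "?d i - 2" "?d j - 2", unfolded mult.assoc] by linarith
    consider "degree n E i = 1" | "degree n E i \<ge> 2" "degree n E j = 1" | "degree n E i = 2" | "degree n E j = 2"
      | "degree n E i \<ge> 3" "degree n E j \<ge> 3"
      using 1 by linarith
    then show ?thesis using 1 True sym amgm by cases (auto simp: adj_def)
  next
    case False
    then have "\<not> E j i" using G by (auto simp: simple_graph_def)
    then show ?thesis using False by (simp add: adj_def)
  qed
  have "excess_form n E \<le> (\<Sum>i<n. \<Sum>j<n. adj E i j * ?l i + (?h i j + ?h j i))"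
    unfolding excess_form_def by (intro sum_mono pt)
  also have "\<dots> = (\<Sum>i<n. \<Sum>j<n. adj E i j * ?l i) + ((\<Sum>i<n. \<Sum>j<n. ?h i j) + (\<Sum>i<n. \<Sum>j<n. ?h j i))"
    by (simp only: sum.distrib)
  also have "(\<Sum>i<n. \<Sum>j<n. ?h j i) = (\<Sum>i<n. \<Sum>j<n. ?h i j)" by (rule sum.swap)
  also have "(\<Sum>i<n. \<Sum>j<n. adj E i j * ?l i) = (\<Sum>i<n. ?l i)"
    unfolding sum_adj_left[OF G] by (intro sum.cong) auto
  also have "(\<Sum>i<n. \<Sum>j<n. ?h i j) + (\<Sum>i<n. \<Sum>j<n. ?h i j)
      = (\<Sum>i<n. ?s i * (?d i - 2)\<^sup>2 * (\<Sum>j<n. adj E i j * ?s j))"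
    by (simp add: sum_distrib_left sum.distrib[symmetric] ac_simps del: sum_mult_of_bool_eq sum_of_bool_mult_eq)
  also have "\<dots> \<le> (\<Sum>i<n. ?s i * (?d i - 2)\<^sup>2 * (real (card S) - 1))"
  proof (intro sum_mono)
    fix i assume i: "i \<in> {..<n}"
    show "?s i * (?d i - 2)\<^sup>2 * (\<Sum>j<n. adj E i j * ?s j) \<le> ?s i * (?d i - 2)\<^sup>2 * (real (card S) - 1)"
    proof (cases "3 \<le> degree n E i")
      case True
      have "(\<Sum>j<n. adj E i j * ?s j) = (\<Sum>j<n. of_bool (E i j \<and> 3 \<le> degree n E j))"
        by (intro sum.cong) (auto simp: adj_def)
      also have "\<dots> = real (card {j \<in> {..<n}. E i j \<and> 3 \<le> degree n E j})" by (simp add: Int_def)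
      also have "card {j \<in> {..<n}. E i j \<and> 3 \<le> degree n E j} \<le> card (S - {i})"
        using G by (intro card_mono) (auto simp: S_def simple_graph_def)
      also have "card (S - {i}) = card S - 1" using True i by (simp add: S_def)
      also have "real (card S - 1) = real (card S) - 1"
      proof -
        have "i \<in> S" using True i by (simp add: S_def)
        then have "card S \<ge> 1" by (metis S_def card_gt_0_iff empty_iff finite_Collect_conjI finite_lessThan
              One_nat_def Suc_leI Collect_mem_eq)
        then show ?thesis by simp
      qed
      finally show ?thesis by (intro mult_left_mono) auto
    qed auto
  qed
  also have "\<dots> = (\<Sum>i<n. if 3 \<le> degree n E i then (?d i - 2)\<^sup>2 * (real (card S) - 1) else 0)"
    by (intro sum.cong) auto
  also have "\<dots> = (\<Sum>i\<in>S. (?d i - 2)\<^sup>2 * (real (card S) - 1))"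
    by (simp add: sum.inter_filter[symmetric] S_def)
  also have "(\<Sum>i<n. ?l i) = real (card {i \<in> {..<n}. degree n E i = 1})" by (simp add: Int_def)
  finally show ?thesis by (simp add: sum_distrib_left mult.commute)
qed

section \<open>Degrees and walk counts of the path\<close>

lemma simple_path_graph: "simple_graph n (path_graph n)"
  by (auto simp: simple_graph_def path_graph_def)

lemma sum_adj_path:
  assumes i: "i < n"
  shows "(\<Sum>j<n. adj (path_graph n) i j * x j)
     = (if 0 < i then x (i - 1) else 0) + (if i + 1 < n then x (i + 1) else 0)"
proof -
  have "(\<Sum>j<n. adj (path_graph n) i j * x j) = (\<Sum>j<n. (if j = i - 1 then if 0 < i then x (i - 1) else 0 else 0)
      + (if j = i + 1 then if i + 1 < n then x (i + 1) else 0 else 0))"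
    using i by (intro sum.cong) (auto simp: adj_def path_graph_def)
  then show ?thesis using i by (simp add: sum.distrib)
qed

lemma degree_path:
  assumes "i < n" "2 \<le> n"
  shows "real (degree n (path_graph n) i) = 2 - (if i = 0 then 1 else 0) - (if i = n - 1 then 1 else 0)"
  using sum_adj_path[OF assms(1), of "\<lambda>_. 1"] assms by (auto simp: real_degree adj_def)

lemma deg_sum_path: "2 \<le> n \<Longrightarrow> deg_sum n (path_graph n) = 2 * real n - 2"
proof -
  assume n: "2 \<le> n"
  have "deg_sum n (path_graph n) = (\<Sum>i<n. 2 - (if i = 0 then 1 else 0) - (if i = n - 1 then 1 else 0))"
    unfolding deg_sum_def using n by (intro sum.cong) (auto simp: degree_path)
  then show ?thesis using n by (simp add: sum_subtractf)
qed

lemma deg_sqsum_path: "2 \<le> n \<Longrightarrow> deg_sqsum n (path_graph n) = 4 * real n - 6"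
proof -
  assume n: "2 \<le> n"
  \<comment> \<open>The degrees are 1 or 2, and both numbers satisfy
    \<open>d^2 = 3 d - 2\<close>.\<close>
  have "deg_sqsum n (path_graph n) = (\<Sum>i<n. 3 * real (degree n (path_graph n) i) - 2)"
    unfolding deg_sqsum_def using n by (intro sum.cong) (auto simp: degree_path)
  also have "\<dots> = 3 * deg_sum n (path_graph n) - 2 * real n"
    by (simp add: sum_subtractf deg_sum_def flip: sum_distrib_left)
  finally show ?thesis using n by (simp add: deg_sum_path)
qed

lemma codeg_path:
  assumes "i < n"
  shows "codeg n (path_graph n) i j = (if 0 < i then adj (path_graph n) (i - 1) j else 0)
    + (if i + 1 < n then adj (path_graph n) (i + 1) j else 0)"
  unfolding codeg_def by (rule sum_adj_path[OF assms])

lemma triangles_path: "triangles n (path_graph n) = 0"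
  unfolding triangles_def
  by (intro sum.neutral ballI) (auto simp: codeg_path adj_def path_graph_def)

lemma quads_path: "quads n (path_graph n) = 0"
  unfolding quads_def
  by (intro sum.neutral ballI) (auto simp: codeg_path adj_def path_graph_def)

lemma excess_form_path: "3 \<le> n \<Longrightarrow> excess_form n (path_graph n) = 0"
  unfolding excess_form_def
  by (intro sum.neutral ballI) (auto simp: degree_path adj_def path_graph_def)

text \<open>The product \<open>(d - 1) (d - 2)\<close> is nonnegative at every natural number, and
  the two moments make its sum zero.\<close>

lemma degrees_one_two:
  assumes s1: "deg_sum n E = 2 * real n - 2" and s2: "deg_sqsum n E = 4 * real n - 6"
    and i: "i < n"
  shows "degree n E i = 1 \<or> degree n E i = 2"
proof -
  let ?d = "\<lambda>i. real (degree n E i)"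
  have nn: "(?d i - 1) * (?d i - 2) \<ge> 0" for i
  proof -
    consider "degree n E i = 0" | "degree n E i = 1" | "degree n E i \<ge> 2" by linarith
    then show ?thesis by cases auto
  qed
  have "(\<Sum>i<n. (?d i - 1) * (?d i - 2)) = (\<Sum>i<n. (?d i)\<^sup>2 - 3 * ?d i + 2)"
    by (simp add: algebra_simps power2_eq_square)
  also have "\<dots> = deg_sqsum n E - 3 * deg_sum n E + 2 * real n"
    by (simp add: sum.distrib sum_subtractf deg_sqsum_def deg_sum_def flip: sum_distrib_left)
  also have "\<dots> = 0" using s1 s2 by simp
  finally have "(?d i - 1) * (?d i - 2) = 0"
    using i nn by (subst (asm) sum_nonneg_eq_0_iff) auto
  then show ?thesis by auto
qed

text \<open>\<open>K\<close>, the sum of \<open>(d - 1) (d - 2)\<close>, equals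
  \<open>deg_sqsum n E - 4 n + 6\<close> and so measures the failure of the claim. If it is nonzero,
  the hypotheses of \<open>excess_arith\<close> can be collected; everything is recast in integers
  for that purpose.\<close>

lemma cospectral_deg_sqsum_zero:
  assumes G: "simple_graph n E" and n: "3 \<le> n"
    and eq: "char_poly (shifted_compl_mat 0 n E) = char_poly (shifted_compl_mat 0 n (path_graph n))"
  shows "deg_sqsum n E = 4 * real n - 6"
proof (rule ccontr)
  assume neg: "deg_sqsum n E \<noteq> 4 * real n - 6"
  define S where "S = {i \<in> {..<n}. 3 \<le> degree n E i}"
  define L where "L = {i \<in> {..<n}. degree n E i = 1}"
  define Z where "Z = {i \<in> {..<n}. degree n E i = 0}"
  define D where "D = {i \<in> {..<n}. 2 \<le> degree n E i}"
  let ?f = "\<lambda>i. int (degree n E i) - 2"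
  define a where "a = (\<Sum>i\<in>S. ?f i)"
  define b where "b = (\<Sum>i\<in>S. (?f i)\<^sup>2)"
  define K where "K = (\<Sum>i<n. ?f i * (?f i + 1))"
  have fin: "finite S" "finite L" "finite Z" "finite D" by (auto simp: S_def L_def Z_def D_def)
  have indS: "(\<Sum>i\<in>S. g i) = (\<Sum>i<n. if 3 \<le> degree n E i then g i else 0)" for g :: "nat \<Rightarrow> int"
    unfolding S_def by (rule sum.inter_filter) simp
  have indc: "int (card {i \<in> {..<n}. P i}) = (\<Sum>i<n. if P i then 1 else 0)" for P
    by (simp only: sum.inter_filter[symmetric] finite_lessThan) simp
  have n2: "2 \<le> n" using n by simp
  note m = cospectral_moments[OF G simple_path_graph eq, unfolded triangles_path quads_path
      excess_form_path[OF n] deg_sum_path[OF n2] deg_sqsum_path[OF n2]]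
  have sumf: "(\<Sum>i<n. ?f i) = - 2"
  proof -
    have "real_of_int (\<Sum>i<n. ?f i) = deg_sum n E - 2 * real n"
      by (simp add: deg_sum_def sum_subtractf)
    then have "real_of_int (\<Sum>i<n. ?f i) = real_of_int (- 2)" using m(1) by simp
    then show ?thesis by (simp only: of_int_eq_iff)
  qed
  have "real_of_int K = (\<Sum>i<n. (real (degree n E i))\<^sup>2 - 3 * real (degree n E i) + 2)"
    by (simp add: K_def algebra_simps power2_eq_square)
  also have "\<dots> = deg_sqsum n E - 3 * deg_sum n E + 2 * real n"
    by (simp add: sum.distrib sum_subtractf deg_sqsum_def deg_sum_def flip: sum_distrib_left)
  finally have K: "real_of_int K = deg_sqsum n E - 4 * real n + 6" using m(1) by simp
  \<comment> \<open>The path has no triangles, so by the third moment a positive \<open>K\<close>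
    produces triangles; they later supply three vertices of degree at least 2.\<close>
  have T: "triangles n E = 3 * real_of_int K" using m(2) K by simp
  have W: "(2 * real n - 7) * real_of_int K \<le> 2 * excess_form n E"
    using m(3) quads_nonneg[of n E] unfolding K by (simp add: algebra_simps)
  have "K \<ge> 0" unfolding K_def
  proof (rule sum_nonneg)
    fix i
    consider "degree n E i = 0" | "degree n E i = 1" | "degree n E i \<ge> 2" by linarith
    then show "?f i * (?f i + 1) \<ge> 0" by cases auto
  qed
  moreover have "K \<noteq> 0" using neg K by auto
  ultimately have Kpos: "K > 0" by simp
  have "?f i = (if 3 \<le> degree n E i then ?f i else 0) - (if degree n E i = 1 then 1 else 0)
      - 2 * (if degree n E i = 0 then 1 else 0)" for i
    by auto
  then have "(\<Sum>i<n. ?f i) = (\<Sum>i<n. (if 3 \<le> degree n E i then ?f i else 0) - (if degree n E i = 1 then 1 else 0)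
      - 2 * (if degree n E i = 0 then 1 else 0))"
    by (intro sum.cong) auto
  then have l: "int (card L) = a + 2 - 2 * int (card Z)"
    unfolding sumf a_def indS L_def Z_def indc by (simp add: sum_subtractf flip: sum_distrib_left)
  have "?f i * (?f i + 1) = (if 3 \<le> degree n E i then ?f i else 0)
      + (if 3 \<le> degree n E i then (?f i)\<^sup>2 else 0) + 2 * (if degree n E i = 0 then 1 else 0)" for i
  proof -
    consider "degree n E i = 0" | "degree n E i = 1" | "degree n E i = 2" | "degree n E i \<ge> 3" by linarith
    then show ?thesis by cases (auto simp: algebra_simps power2_eq_square)
  qed
  then have ab: "a + b + 2 * int (card Z) = K"
    unfolding a_def b_def indS Z_def indc K_def by (simp add: sum.distrib flip: sum_distrib_left)
  have f1: "?f i \<ge> 1" if "i \<in> S" for i using that by (auto simp: S_def)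
  have sa: "int (card S) \<le> a"
    unfolding a_def using sum_mono[of S "\<lambda>_. 1" ?f] f1 by simp
  have asb: "a \<le> b" unfolding a_def b_def
  proof (intro sum_mono)
    fix i assume "i \<in> S"
    then show "?f i \<le> (?f i)\<^sup>2" using f1[of i] mult_right_mono[of 1 "?f i" "?f i"] by (simp add: power2_eq_square)
  qed
  have s1: "b = a\<^sup>2" if "int (card S) = 1"
  proof -
    have "card S = 1" using that by simp
    then obtain v where "S = {v}" by (rule card_1_singletonE)
    then show ?thesis by (simp add: a_def b_def)
  qed
  have s0: "a = 0 \<and> b = 0" if "int (card S) = 0"
    using that fin by (simp add: a_def b_def)
  have rb: "(\<Sum>i\<in>S. (real (degree n E i) - 2)\<^sup>2) = real_of_int b"
    by (simp add: b_def)
  have "real_of_int ((2 * int n - 7) * K) \<le> real_of_int (2 * int (card L) + 2 * ((int (card S) - 1) * b))"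
    using W excess_form_le[OF G, folded S_def L_def] unfolding rb by simp
  then have main: "(2 * int n - 7) * K \<le> 2 * int (card L) + 2 * ((int (card S) - 1) * b)"
    by (simp only: of_int_le_iff)
  have "(\<Sum>i<n. (if degree n E i = 1 then 1 else 0) + (if degree n E i = 0 then 1 else 0)
       + (if 2 \<le> degree n E i then 1 else 0)) = (\<Sum>i<n. (1::int))"
    by (intro sum.cong) auto
  then have cn: "int (card L) + int (card Z) + int (card D) = int n"
    unfolding L_def Z_def D_def indc by (simp add: sum.distrib)
  have c3: "3 \<le> int (card D)" using triangles_nonzero[OF G] T Kpos by (simp add: D_def)
  have "card S \<le> card D" using fin by (intro card_mono) (auto simp: S_def D_def)
  then have sc: "int (card S) \<le> int (card D)" by simp
  \<comment> \<open>Degrees are at least 3 on \<open>S\<close> and add up to \<open>2 n - 2\<close>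
    over all vertices.\<close>
  have sn: "3 * int (card S) \<le> 2 * int n - 2"
  proof -
    have "3 * int (card S) \<le> (\<Sum>i\<in>S. int (degree n E i))"
      using sum_mono[of S "\<lambda>_. 3" "\<lambda>i. int (degree n E i)"] by (auto simp: S_def)
    also have "\<dots> \<le> (\<Sum>i<n. int (degree n E i))" by (intro sum_mono2) (auto simp: S_def)
    also have "\<dots> = 2 * int n - 2" using sumf by (simp add: sum_subtractf)
    finally show ?thesis .
  qed
  show False
    by (rule excess_arith[OF _ _ _ Kpos l ab sa asb s1 s0 main cn c3 sc sn]) auto
qed

subsection \<open>Graphs with all degrees 1 or 2\<close>

lemma card_le_degree:
  assumes "simple_graph n E" "\<And>w. w \<in> A \<Longrightarrow> E v w"
  shows "card A \<le> degree n E v"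
proof -
  have "A \<subseteq> {j \<in> {0..<n}. E v j}" using assms by (auto simp: simple_graph_def)
  then show ?thesis unfolding degree_def by (intro card_mono) auto
qed

lemma neighbour_unique:
  assumes "simple_graph n E" "degree n E v \<le> 1" "E v u" "E v x"
  shows "x = u"
proof (rule ccontr)
  assume "x \<noteq> u"
  then show False using card_le_degree[OF assms(1), of "{u, x}" v] assms by auto
qed

lemma neighbours_two:
  assumes "simple_graph n E" "degree n E v \<le> 2" "E v u" "E v w" "u \<noteq> w" "E v x"
  shows "x = u \<or> x = w"
proof (rule ccontr)
  assume "\<not> ?thesis"
  then show False using card_le_degree[OF assms(1), of "{u, w, x}" v] assms by auto
qed

text \<open>\<open>u\<close> is arbitrary, not necessarily a neighbour: of two distinct neighbours
  at least one differs from it.\<close>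

lemma other_neighbour:
  assumes "degree n E v = 2"
  obtains w where "w \<noteq> u" "E v w"
proof -
  have "card {j \<in> {0..<n}. E v j} = 2" using assms by (simp add: degree_def)
  then obtain x y where "x \<noteq> y" "{j \<in> {0..<n}. E v j} = {x, y}" by (auto simp: card_2_iff)
  then have "x \<noteq> y" "E v x" "E v y" by blast+
  then show thesis using that by metis
qed

section \<open>Maximal paths and the components they span\<close>

definition is_path :: "(nat \<Rightarrow> nat \<Rightarrow> bool) \<Rightarrow> nat set \<Rightarrow> nat list \<Rightarrow> bool" where
  "is_path E V xs \<longleftrightarrow> xs \<noteq> [] \<and> distinct xs \<and> set xs \<subseteq> V \<and>
     (\<forall>i. Suc i < length xs \<longrightarrow> E (xs ! i) (xs ! Suc i))"

lemma is_path_snoc: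
  assumes "is_path E V xs" "w \<in> V" "w \<notin> set xs" "E (last xs) w"
  shows "is_path E V (xs @ [w])"
proof -
  have "E ((xs @ [w]) ! i) ((xs @ [w]) ! Suc i)" if "Suc i < length (xs @ [w])" for i
  proof (cases "Suc i < length xs")
    case True then show ?thesis using assms by (auto simp: is_path_def nth_append)
  next
    case False
    then have "length xs = Suc i" using that by simp
    moreover have "last xs = xs ! i" using calculation by (metis diff_Suc_1 last_conv_nth list.size(3) nat.distinct(1))
    ultimately show ?thesis using assms(4) by (simp add: nth_append)
  qed
  then show ?thesis using assms by (auto simp: is_path_def)
qed

text \<open>Path lengths are bounded by \<open>card V\<close>, and a longest path from
  \<open>a\<close> cannot be continued by a new neighbour of its last vertex.\<close>

lemma maximal_path:
  assumes V: "finite V" "a \<in> V"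
  obtains xs where "is_path E V xs" "xs ! 0 = a" "\<And>w. w \<in> V \<Longrightarrow> E (last xs) w \<Longrightarrow> w \<in> set xs"
proof -
  let ?P = "\<lambda>xs. is_path E V xs \<and> xs ! 0 = a"
  have 0: "?P [a]" using V by (simp add: is_path_def)
  have b: "length ys \<le> card V" if "?P ys" for ys
    using that V by (metis is_path_def card_mono distinct_card)
  obtain xs where xs: "?P xs" "\<And>ys. ?P ys \<Longrightarrow> length ys \<le> length xs"
    using ex_has_greatest_nat[of ?P "[a]" length "Suc (card V)", OF 0] b by (meson less_Suc_eq_le)
  have "w \<in> set xs" if "w \<in> V" "E (last xs) w" for w
  proof (rule ccontr)
    assume "w \<notin> set xs"
    then have "is_path E V (xs @ [w])" using xs(1) that is_path_snoc by blast
    moreover have "(xs @ [w]) ! 0 = a" using xs(1) by (auto simp: is_path_def nth_append)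
    ultimately have "?P (xs @ [w])" by simp
    then show False using xs(2)[of "xs @ [w]"] by simp
  qed
  then show thesis using that xs by blast
qed

lemma is_path_inner_neighbour:
  assumes G: "simple_graph n E" and p: "is_path E V xs" and d: "\<And>v. v \<in> V \<Longrightarrow> degree n E v \<le> 2"
    and i: "0 < i" "Suc i < length xs" and e: "E (xs ! i) w"
  shows "w = xs ! (i - 1) \<or> w = xs ! Suc i"
proof (rule neighbours_two[OF G _ _ _ _ e])
  have V: "xs ! i \<in> V" using p i by (auto simp: is_path_def)
  show "degree n E (xs ! i) \<le> 2" by (rule d[OF V])
  have "Suc (i - 1) < length xs" using i by simp
  then have "E (xs ! (i - 1)) (xs ! Suc (i - 1))" using p unfolding is_path_def by blast
  then have "E (xs ! (i - 1)) (xs ! i)" using i by simp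
  then show "E (xs ! i) (xs ! (i - 1))" using G by (auto simp: simple_graph_def)
  show "E (xs ! i) (xs ! Suc i)" using p i by (auto simp: is_path_def)
  show "xs ! (i - 1) \<noteq> xs ! Suc i" using p i by (auto simp: is_path_def nth_eq_iff_index_eq)
qed

text \<open>An inner vertex already has its two neighbours on the path, so it meets the last vertex
  only as its predecessor. The remaining possibility is the first vertex, which closes a
  cycle.\<close>

lemma is_path_last_neighbour:
  assumes G: "simple_graph n E" and p: "is_path E V xs" and d: "\<And>v. v \<in> V \<Longrightarrow> degree n E v \<le> 2"
    and j: "j < length xs" and e: "E (xs ! (length xs - 1)) (xs ! j)"
  shows "j = 0 \<or> j = length xs - 2"
proof (rule ccontr)
  assume neg: "\<not> ?thesis"
  have ne: "j \<noteq> length xs - 1" using e G by (auto simp: simple_graph_def)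
  with neg j have j': "0 < j" "Suc j < length xs" by auto
  have dist: "distinct xs" using p by (simp add: is_path_def)
  have "E (xs ! j) (xs ! (length xs - 1))" using e G by (auto simp: simple_graph_def)
  from is_path_inner_neighbour[OF G p d j' this]
  have "length xs - 1 = j - 1 \<or> length xs - 1 = Suc j"
    using dist j' by (simp add: nth_eq_iff_index_eq)
  then show False using neg j' by auto
qed

text \<open>A maximal path from a leaf cannot close up into a cycle, since the leaf has no second
  neighbour. It therefore ends in another leaf, and no edge leaves it.\<close>

lemma leaf_path_component:
  assumes G: "simple_graph n E" and d: "\<And>v. v < n \<Longrightarrow> degree n E v = 1 \<or> degree n E v = 2"
    and a: "a < n" "degree n E a = 1"
  obtains xs where "is_path E {..<n} xs" "2 \<le> length xs" "xs ! 0 = a"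
    "degree n E (xs ! (length xs - 1)) = 1"
    "\<And>i w. i < length xs \<Longrightarrow> E (xs ! i) w \<longleftrightarrow> (0 < i \<and> w = xs ! (i - 1)) \<or> (Suc i < length xs \<and> w = xs ! Suc i)"
proof -
  obtain xs where p: "is_path E {..<n} xs" and x0: "xs ! 0 = a"
    and mx: "\<And>w. w \<in> {..<n} \<Longrightarrow> E (last xs) w \<Longrightarrow> w \<in> set xs"
    using maximal_path[of "{..<n}" a E] a by blast
  let ?l = "length xs"
  have ne: "xs \<noteq> []" and dist: "distinct xs" and sub: "set xs \<subseteq> {..<n}"
    and st: "\<And>i. Suc i < ?l \<Longrightarrow> E (xs ! i) (xs ! Suc i)" using p by (auto simp: is_path_def)
  have lst: "last xs = xs ! (?l - 1)" using ne by (simp add: last_conv_nth)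
  have sym: "E x y \<Longrightarrow> E y x" and irr: "\<not> E x x" and lt: "E x y \<Longrightarrow> y < n" for x y
    using G by (auto simp: simple_graph_def)
  have d2: "degree n E v \<le> 2" if "v \<in> {..<n}" for v using d that by fastforce
  have two: "2 \<le> ?l"
  proof (rule ccontr)
    assume "\<not> 2 \<le> ?l"
    then have "xs = [a]" using ne x0 by (cases xs) (auto simp: not_le less_Suc_eq)
    moreover obtain w where "E a w"
    proof -
      have "{j \<in> {0..<n}. E a j} \<noteq> {}" using a(2) unfolding degree_def by (metis card.empty zero_neq_one)
      then show ?thesis using that by blast
    qed
    ultimately have "w \<in> set [a]" using mx lt by auto
    then show False using \<open>E a w\<close> irr by auto
  qed
  have first: "w = xs ! 1" if "E (xs ! 0) w" for w
    using neighbour_unique[OF G _ st[of 0] that] two x0 a by auto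
  have lastn: "w = xs ! (?l - 2)" if e: "E (xs ! (?l - 1)) w" for w
  proof -
    have "w \<in> set xs" using mx[of w] e lt lst by simp
    then obtain j where j: "j < ?l" "w = xs ! j" by (auto simp: in_set_conv_nth)
    then consider "j = 0" | "j = ?l - 2" using is_path_last_neighbour[OF G p d2, of j] e by auto
    then show ?thesis
    proof cases
      \<comment> \<open>An edge from the last vertex to the leaf is the only edge of the leaf. The
        path then has two vertices, and the indices \<open>0\<close> and \<open>?l - 2\<close>
        coincide.\<close>
      case 1
      then have "E (xs ! 0) (xs ! (?l - 1))" using e j sym by auto
      then have "xs ! (?l - 1) = xs ! 1" by (rule first)
      then have "?l - 1 = 1" using dist two by (subst (asm) nth_eq_iff_index_eq) auto
      then show ?thesis using 1 j by (metis diff_Suc_1 diff_diff_left one_add_one diff_self_eq_0)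
    qed (use j in auto)
  qed
  have dl: "degree n E (xs ! (?l - 1)) = 1"
  proof -
    have "xs ! (?l - 1) < n" using sub ne by (metis last_in_set lst lessThan_iff subsetD)
    moreover have "degree n E (xs ! (?l - 1)) \<noteq> 2" using other_neighbour lastn by metis
    ultimately show ?thesis using d by blast
  qed
  have "E (xs ! i) w \<longleftrightarrow> (0 < i \<and> w = xs ! (i - 1)) \<or> (Suc i < ?l \<and> w = xs ! Suc i)" if i: "i < ?l" for i w
  proof
    assume e: "E (xs ! i) w"
    consider "i = 0" | "i = ?l - 1" "0 < i" | "0 < i" "Suc i < ?l" using i by linarith
    then show "(0 < i \<and> w = xs ! (i - 1)) \<or> (Suc i < ?l \<and> w = xs ! Suc i)"
    proof cases
      case 1 then show ?thesis using first e two by auto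
    next
      case 2
      then have "w = xs ! (?l - 2)" using lastn e by simp
      moreover have "?l - 2 = i - 1" using 2 by simp
      ultimately show ?thesis using 2 by simp
    next
      case 3 then show ?thesis using is_path_inner_neighbour[OF G p d2 _ _ e] by auto
    qed
  next
    assume "(0 < i \<and> w = xs ! (i - 1)) \<or> (Suc i < ?l \<and> w = xs ! Suc i)"
    then show "E (xs ! i) w" using st[of "i - 1"] st[of i] sym i by auto
  qed
  then show thesis using that p two x0 dl by blast
qed

text \<open>Writing the cyclic predecessor with \<open>i + l - 1\<close> avoids truncated
  subtraction at \<open>i = 0\<close>.\<close>

lemma pred_mod:
  assumes "i < l"
  shows "(i + l - 1) mod l = (if i = 0 then l - 1 else i - (1::nat))"
proof (cases "i = 0")
  case False
  then have "(i + l - 1) mod l = (i - 1 + l) mod l" by simp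
  also have "\<dots> = i - 1" using assms by (simp only: mod_add_self2) simp
  finally show ?thesis using False by simp
qed (use assms in auto)

lemma Suc_mod: "i < l \<Longrightarrow> Suc i mod l = (if Suc i = l then 0 else Suc i)"
  by auto

text \<open>The last vertex of a maximal path has a neighbour besides its predecessor; it lies on
  the path and can only be the first vertex. The closed cycle exhausts the degrees, so its vertices
  have no further edges.\<close>

lemma two_regular_cycle:
  assumes G: "simple_graph n E" and V: "V \<subseteq> {..<n}" "V \<noteq> {}"
    and d: "\<And>v. v \<in> V \<Longrightarrow> degree n E v = 2" and cl: "\<And>v w. v \<in> V \<Longrightarrow> E v w \<Longrightarrow> w \<in> V"
  obtains ys where "distinct ys" "set ys \<subseteq> V" "3 \<le> length ys"
    "\<And>i w. i < length ys \<Longrightarrow> E (ys ! i) w \<longleftrightarrow>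
       w = ys ! (Suc i mod length ys) \<or> w = ys ! ((i + length ys - 1) mod length ys)"
proof -
  have fV: "finite V" using V finite_subset by blast
  obtain a where "a \<in> V" using V by blast
  then obtain xs where p: "is_path E V xs"
    and mx: "\<And>w. w \<in> V \<Longrightarrow> E (last xs) w \<Longrightarrow> w \<in> set xs"
    using maximal_path[OF fV] by blast
  let ?l = "length xs"
  have ne: "xs \<noteq> []" and dist: "distinct xs" and sub: "set xs \<subseteq> V"
    and st: "\<And>i. Suc i < ?l \<Longrightarrow> E (xs ! i) (xs ! Suc i)" using p by (auto simp: is_path_def)
  have lst: "last xs = xs ! (?l - 1)" using ne by (simp add: last_conv_nth)
  have sym: "E x y \<Longrightarrow> E y x" and irr: "\<not> E x x" for x y
    using G by (auto simp: simple_graph_def)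
  have d2: "degree n E v \<le> 2" if "v \<in> V" for v using d that by fastforce
  have lV: "last xs \<in> V" using sub ne by auto
  have idx: "\<exists>j<?l. w = xs ! j \<and> (j = 0 \<or> j = ?l - 2)" if e: "E (xs ! (?l - 1)) w" for w
  proof -
    have "w \<in> set xs" using mx[of w] e lst cl lV by simp
    then obtain j where j: "j < ?l" "w = xs ! j" by (auto simp: in_set_conv_nth)
    then show ?thesis using is_path_last_neighbour[OF G p d2, of j] e by auto
  qed
  obtain w1 where w1: "w1 \<noteq> xs ! (?l - 2)" "E (xs ! (?l - 1)) w1"
    using other_neighbour[OF d[OF lV]] lst by metis
  then have e0: "E (xs ! (?l - 1)) (xs ! 0)" and n0: "xs ! 0 \<noteq> xs ! (?l - 2)"
    using idx[OF w1(2)] by auto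
  have three: "3 \<le> ?l"
  proof (rule ccontr)
    assume "\<not> 3 \<le> ?l"
    \<comment> \<open>With truncated subtraction the index \<open>?l - 2\<close> is 0 for paths of
      one or two vertices, against \<open>n0\<close>.\<close>
    then have "?l - 2 = 0" by simp
    then show False using n0 by simp
  qed
  have xV: "xs ! i \<in> V" if "i < ?l" for i using that sub by auto
  have "E (xs ! i) w \<longleftrightarrow> w = xs ! (Suc i mod ?l) \<or> w = xs ! ((i + ?l - 1) mod ?l)" if i: "i < ?l" for i w
  proof -
    note nxt = Suc_mod[OF i] and prv = pred_mod[OF i]
    have e1: "E (xs ! i) (xs ! (Suc i mod ?l))"
    proof (cases "Suc i = ?l")
      case True
      then have "i = ?l - 1" by simp
      then show ?thesis using e0 nxt True by simp
    next
      case False then show ?thesis using st[of i] i nxt by simp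
    qed
    have e2: "E (xs ! i) (xs ! ((i + ?l - 1) mod ?l))"
    proof (cases "i = 0")
      case True
      then show ?thesis using sym[OF e0] prv by simp
    next
      case False
      then show ?thesis using sym[OF st[of "i - 1"]] prv i by simp
    qed
    have "Suc i mod ?l \<noteq> (i + ?l - 1) mod ?l"
      unfolding nxt prv using three i by auto
    then have ne2: "xs ! (Suc i mod ?l) \<noteq> xs ! ((i + ?l - 1) mod ?l)"
      using dist ne by (simp add: nth_eq_iff_index_eq)
    show ?thesis
      using neighbours_two[OF G d2[OF xV[OF i]] e1 e2 ne2] e1 e2 by auto
  qed
  then show thesis using that[OF dist sub three] by blast
qed

text \<open>The degree sum leaves room for exactly two leaves, and the path component through one of
  them contains both. All other vertices have degree 2, so if there are any they contain a cycle,
  which misses the at least two vertices of the path.\<close>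

lemma path_graph_or_cycle:
  assumes G: "simple_graph n E" and n: "1 \<le> n"
    and d: "\<And>v. v < n \<Longrightarrow> degree n E v = 1 \<or> degree n E v = 2"
    and s: "(\<Sum>i<n. degree n E i) = 2 * n - 2"
  shows "(\<exists>xs. distinct xs \<and> set xs = {..<n} \<and> (\<forall>i<n. \<forall>j<n. E (xs ! i) (xs ! j) \<longleftrightarrow> path_graph n i j)) \<or>
    (\<exists>ys. distinct ys \<and> set ys \<subseteq> {..<n} \<and> 3 \<le> length ys \<and> length ys + 2 \<le> n \<and>
       (\<forall>i<length ys. degree n E (ys ! i) = 2 \<and> (\<forall>w. E (ys ! i) w \<longleftrightarrow>
       w = ys ! (Suc i mod length ys) \<or> w = ys ! ((i + length ys - 1) mod length ys))))"
proof -
  \<comment> \<open>Adding 1 at each leaf raises all degrees to 2, so there are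
    \<open>2 n - (2 n - 2)\<close> leaves.\<close>
  have "(\<Sum>i<n. degree n E i) + card {i \<in> {..<n}. degree n E i = 1} = (\<Sum>i<n. degree n E i + (if degree n E i = 1 then 1 else 0))"
    by (simp only: sum.distrib sum.inter_filter[symmetric] finite_lessThan) simp
  also have "\<dots> = (\<Sum>i<n. 2)" using d by (intro sum.cong) fastforce+
  finally have leaves: "card {i \<in> {..<n}. degree n E i = 1} = 2" using s n by simp
  then obtain a where a: "a < n" "degree n E a = 1"
    by (metis (mono_tags, lifting) card.empty empty_Collect_eq lessThan_iff zero_neq_numeral)
  obtain xs where p: "is_path E {..<n} xs" and two: "2 \<le> length xs" and x0: "xs ! 0 = a"
    and dl: "degree n E (xs ! (length xs - 1)) = 1"
    and nb: "\<And>i w. i < length xs \<Longrightarrow> E (xs ! i) w \<longleftrightarrow> (0 < i \<and> w = xs ! (i - 1)) \<or> (Suc i < length xs \<and> w = xs ! Suc i)"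
    using leaf_path_component[OF G d a] by blast
  have dist: "distinct xs" and sub: "set xs \<subseteq> {..<n}" using p by (auto simp: is_path_def)
  show ?thesis
  proof (cases "set xs = {..<n}")
    case True
    then have l: "length xs = n" using distinct_card[OF dist] by simp
    have "E (xs ! i) (xs ! j) \<longleftrightarrow> path_graph n i j" if "i < n" "j < n" for i j
      using that nb[of i "xs ! j"] dist l by (auto simp: path_graph_def nth_eq_iff_index_eq)
    then show ?thesis using dist True by blast
  next
    case False
    let ?V = "{..<n} - set xs"
    have V: "?V \<subseteq> {..<n}" "?V \<noteq> {}" using False sub by auto
    have ends: "{a, xs ! (length xs - 1)} = {i \<in> {..<n}. degree n E i = 1}"
    proof (rule card_subset_eq)
      have "xs ! (length xs - 1) \<in> set xs" using two by simp
      then show "{a, xs ! (length xs - 1)} \<subseteq> {i \<in> {..<n}. degree n E i = 1}" using a dl sub by auto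
      have "a \<noteq> xs ! (length xs - 1)" using dist two unfolding x0[symmetric] by (subst nth_eq_iff_index_eq) auto
      then show "card {a, xs ! (length xs - 1)} = card {i \<in> {..<n}. degree n E i = 1}" using leaves by simp
    qed simp
    have dV: "degree n E v = 2" if "v \<in> ?V" for v
    proof -
      have "xs ! 0 \<in> set xs" "xs ! (length xs - 1) \<in> set xs" using two by (auto intro!: nth_mem)
      then have "v \<notin> {a, xs ! (length xs - 1)}" using that x0 by auto
      then show ?thesis using d that unfolding ends by auto
    qed
    have cl: "w \<in> ?V" if v: "v \<in> ?V" and e: "E v w" for v w
    proof -
      have ew: "E w v" "w < n" using e G by (auto simp: simple_graph_def)
      have "w \<notin> set xs"
      proof
        assume "w \<in> set xs"
        then obtain i where i: "i < length xs" "w = xs ! i" by (auto simp: in_set_conv_nth)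
        then have "v \<in> set xs" using nb[OF i(1), of v] ew by auto
        then show False using v by simp
      qed
      then show ?thesis using ew by simp
    qed
    obtain ys where ys: "distinct ys" "set ys \<subseteq> ?V" "3 \<le> length ys"
      "\<And>i w. i < length ys \<Longrightarrow> E (ys ! i) w \<longleftrightarrow>
       w = ys ! (Suc i mod length ys) \<or> w = ys ! ((i + length ys - 1) mod length ys)"
      by (rule two_regular_cycle[OF G V dV]) (assumption | erule (1) cl | blast)+
    have "card (set xs \<union> set ys) = length xs + length ys"
      using ys dist by (subst card_Un_disjoint) (auto simp: distinct_card)
    moreover have "card (set xs \<union> set ys) \<le> card {..<n}" using sub ys by (intro card_mono) auto
    ultimately have "length ys + 2 \<le> n" using two by simp
    moreover have "degree n E (ys ! i) = 2" if "i < length ys" for i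
      using dV nth_mem[OF that] ys(2) by blast
    ultimately show ?thesis using ys by blast
  qed
qed

subsection \<open>Double eigenvalues\<close>

text \<open>The eigenvector equation of \<open>shifted_compl_mat\<close> for functions on the
  vertices, the zero function being allowed; this spares vector operations in the recurrences
  below.\<close>

definition is_eigenfun :: "real \<Rightarrow> nat \<Rightarrow> (nat \<Rightarrow> nat \<Rightarrow> bool) \<Rightarrow> real \<Rightarrow> (nat \<Rightarrow> real) \<Rightarrow> bool" where
  "is_eigenfun \<alpha> n E k x \<longleftrightarrow> (\<forall>i<n. (1 - \<alpha>) * ((\<Sum>j<n. x j) - (\<Sum>j<n. adj E i j * x j))
     - \<alpha> * real (degree n E i) * x i = k * x i)"

lemma is_eigenfun_linear:
  assumes "is_eigenfun \<alpha> n E k x" "is_eigenfun \<alpha> n E k y"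
  shows "is_eigenfun \<alpha> n E k (\<lambda>i. p * x i + q * y i)"
  unfolding is_eigenfun_def
proof (intro allI impI)
  fix i assume i: "i < n"
  have "(\<Sum>j<n. p * x j + q * y j) = p * (\<Sum>j<n. x j) + q * (\<Sum>j<n. y j)"
    by (simp add: sum.distrib sum_distrib_left)
  moreover have "(\<Sum>j<n. adj E i j * (p * x j + q * y j)) = p * (\<Sum>j<n. adj E i j * x j) + q * (\<Sum>j<n. adj E i j * y j)"
    by (simp add: sum.distrib sum_distrib_left algebra_simps)
  moreover have "p * ((1 - \<alpha>) * ((\<Sum>j<n. x j) - (\<Sum>j<n. adj E i j * x j)) - \<alpha> * real (degree n E i) * x i)
    + q * ((1 - \<alpha>) * ((\<Sum>j<n. y j) - (\<Sum>j<n. adj E i j * y j)) - \<alpha> * real (degree n E i) * y i)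
    = p * (k * x i) + q * (k * y i)"
    using assms i by (simp add: is_eigenfun_def)
  ultimately show "(1 - \<alpha>) * ((\<Sum>j<n. p * x j + q * y j) - (\<Sum>j<n. adj E i j * (p * x j + q * y j)))
     - \<alpha> * real (degree n E i) * (p * x i + q * y i) = k * (p * x i + q * y i)"
    by (simp add: algebra_simps)
qed

lemma is_eigenfun_iff_mult_mat_vec:
  "is_eigenfun \<alpha> n E k x \<longleftrightarrow> shifted_compl_mat \<alpha> n E *\<^sub>v vec n x = k \<cdot>\<^sub>v vec n x"
proof -
  have *: "(shifted_compl_mat \<alpha> n E *\<^sub>v vec n x) $ i
     = (1 - \<alpha>) * ((\<Sum>j<n. x j) - (\<Sum>j<n. adj E i j * x j)) - \<alpha> * real (degree n E i) * x i" if "i < n" for i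
  proof -
    have "(shifted_compl_mat \<alpha> n E *\<^sub>v vec n x) $ i
      = (\<Sum>j<n. (1 - \<alpha>) * x j - (1 - \<alpha>) * (adj E i j * x j) - (if j = i then \<alpha> * real (degree n E i) * x i else 0))"
      using that by (auto simp: shifted_compl_mat_def scalar_prod_def atLeast0LessThan algebra_simps intro!: sum.cong)
    then show ?thesis using that by (simp add: sum_subtractf sum_distrib_left right_diff_distrib)
  qed
  have d: "dim_vec (shifted_compl_mat \<alpha> n E *\<^sub>v vec n x) = n"
    by (simp add: shifted_compl_mat_def)
  show ?thesis unfolding vec_eq_iff d is_eigenfun_def using * by auto
qed

lemma shifted_compl_mat_transpose:
  "simple_graph n E \<Longrightarrow> transpose_mat (shifted_compl_mat \<alpha> n E) = shifted_compl_mat \<alpha> n E"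
  by (auto simp: shifted_compl_mat_def adj_def simple_graph_def intro!: eq_matI)

text \<open>Pairing with the all-ones vector: the adjacency and degree terms both become
  degree-weighted sums, with weights \<open>1 - \<alpha>\<close> and \<open>\<alpha>\<close> that
  add up to 1.\<close>

lemma is_eigenfun_sum:
  assumes G: "simple_graph n E" and x: "is_eigenfun \<alpha> n E k x"
  shows "(1 - \<alpha>) * real n * (\<Sum>i<n. x i) - (\<Sum>i<n. real (degree n E i) * x i) = k * (\<Sum>i<n. x i)"
proof -
  have "(\<Sum>i<n. k * x i) = (\<Sum>i<n. (1 - \<alpha>) * (\<Sum>j<n. x j) - (1 - \<alpha>) * (\<Sum>j<n. adj E i j * x j)
     - \<alpha> * (real (degree n E i) * x i))"
    using x by (intro sum.cong) (auto simp: is_eigenfun_def algebra_simps)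
  also have "\<dots> = real n * ((1 - \<alpha>) * (\<Sum>j<n. x j)) - (1 - \<alpha>) * (\<Sum>i<n. \<Sum>j<n. adj E i j * x j)
     - \<alpha> * (\<Sum>i<n. real (degree n E i) * x i)"
    by (simp add: sum_subtractf flip: sum_distrib_left)
  finally show ?thesis
    unfolding sum_adj_right[OF G] by (simp add: algebra_simps flip: sum_distrib_left)
qed

section \<open>Eigenvectors of the path as solutions of a recurrence\<close>

context
  fixes \<alpha> \<beta> \<theta> k :: real and n :: nat
  assumes b: "\<beta> = 1 - \<alpha>" "\<beta> > 0" and th: "\<theta> = k + 2" and n: "3 \<le> n"
begin

text \<open>The degree is 1 at an end, so the coefficient \<open>- (\<alpha> + k)\<close> appears as
  \<open>1 + \<beta> - \<theta>\<close>; at inner vertices it is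
  \<open>- (2 \<alpha> + k) = 2 \<beta> - \<theta>\<close>.\<close>

lemma path_eig_first:
  assumes "is_eigenfun \<alpha> n (path_graph n) k x"
  shows "\<beta> * x 1 = (1 + \<beta> - \<theta>) * x 0 + \<beta> * (\<Sum>i<n. x i)"
proof -
  have "0 < n" using n by simp
  from assms[unfolded is_eigenfun_def, rule_format, OF this] show ?thesis
    using n unfolding sum_adj_path[OF \<open>0 < n\<close>] by (simp add: degree_path b th algebra_simps)
qed

lemma path_eig_last:
  assumes "is_eigenfun \<alpha> n (path_graph n) k x"
  shows "\<beta> * x (n - 2) = (1 + \<beta> - \<theta>) * x (n - 1) + \<beta> * (\<Sum>i<n. x i)"
proof -
  have "n - 1 < n" using n by simp
  moreover have "n - 1 - 1 = n - 2" by simp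
  ultimately show ?thesis
    using assms[unfolded is_eigenfun_def, rule_format, OF \<open>n - 1 < n\<close>] n
    unfolding sum_adj_path[OF \<open>n - 1 < n\<close>] by (simp add: degree_path b th algebra_simps)
qed

lemma path_eig_inner:
  assumes "is_eigenfun \<alpha> n (path_graph n) k x" "Suc (Suc i) < n"
  shows "\<beta> * (x i + x (Suc (Suc i))) = (2 * \<beta> - \<theta>) * x (Suc i) + \<beta> * (\<Sum>i<n. x i)"
proof -
  have "Suc i < n" using assms by simp
  moreover have "real (degree n (path_graph n) (Suc i)) = 2" using assms(2) n by (simp add: degree_path)
  ultimately show ?thesis
    using assms(1)[unfolded is_eigenfun_def, rule_format, OF \<open>Suc i < n\<close>] assms(2)
    unfolding sum_adj_path[OF \<open>Suc i < n\<close>] by (simp add: b th algebra_simps)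
qed

text \<open>On the path the degree-weighted sum is twice the plain sum minus the two end values. In
  particular, the end values are opposite when the sum is zero.\<close>

lemma path_eig_ends:
  assumes "is_eigenfun \<alpha> n (path_graph n) k x"
  shows "x 0 + x (n - 1) = (\<theta> - \<beta> * real n) * (\<Sum>i<n. x i)"
proof -
  have "(\<Sum>i<n. real (degree n (path_graph n) i) * x i) =
    (\<Sum>i<n. 2 * x i - (if i = 0 then x 0 else 0) - (if i = n - 1 then x (n - 1) else 0))"
    using n by (intro sum.cong) (auto simp: degree_path algebra_simps)
  also have "\<dots> = 2 * (\<Sum>i<n. x i) - x 0 - x (n - 1)"
    using n by (simp add: sum_subtractf sum_distrib_left)
  finally show ?thesis
    using is_eigenfun_sum[OF simple_path_graph assms] by (simp add: b th algebra_simps)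
qed

text \<open>The equations determine \<open>x\<close> from its sum and from \<open>x 0\<close>, so an
  eigenspace has dimension at most 2.\<close>

lemma path_eig_zero:
  assumes x: "is_eigenfun \<alpha> n (path_graph n) k x" and s: "(\<Sum>i<n. x i) = 0" and x0: "x 0 = 0" and i: "i < n"
  shows "x i = 0"
  using i
proof (induction i rule: less_induct)
  case (less i)
  consider "i = 0" | "i = 1" | j where "i = Suc (Suc j)"
    by (metis One_nat_def old.nat.exhaust)
  then show ?case
  proof cases
    case 3
    then show ?thesis using path_eig_inner[OF x, of j] less.IH[of j] less.IH[of "Suc j"] less.prems s b by simp
  qed (use x0 path_eig_first[OF x] s b in auto)
qed

text \<open>Away from the ends, \<open>y\<close> and \<open>x + 1/\<theta>\<close> satisfy the same second order linear recurrence, so the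
  polarised energy form of the recurrence is constant along the path. The reflection of the path
  fixes \<open>x\<close> and negates \<open>y\<close>, hence it vanishes; this is an algebraic relation between \<open>\<alpha>\<close>, \<open>\<theta>\<close> and \<open>n\<close>.\<close>

lemma path_double_eigenvalue_core:
  assumes x: "is_eigenfun \<alpha> n (path_graph n) k x" and y: "is_eigenfun \<alpha> n (path_graph n) k y"
    and sy: "(\<Sum>i<n. y i) = 0" and y0: "y 0 \<noteq> 0"
    and sx: "(\<Sum>i<n. x i) = - 1 / \<beta>" and xs: "x 0 = x (n - 1)" and th0: "\<theta> \<noteq> 0"
  shows "(real n - \<theta> / \<beta>) * (1 - \<alpha> * \<theta>) = 2 * \<alpha> - 1"
proof -
  \<comment> \<open>With the sum normalised to \<open>- 1 / \<beta>\<close>, the inhomogeneous term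
    of the recurrence is \<open>- 1\<close> and its constant solution is
    \<open>- 1 / \<theta>\<close>; subtracting that gives the homogeneous solution
    \<open>t\<close>.\<close>
  define t where "t = (\<lambda>i. x i + 1 / \<theta>)"
  define h where "h = 2 - \<theta> / \<beta>"
  have b0: "\<beta> \<noteq> 0" using b by simp
  have yi: "y i + y (Suc (Suc i)) = h * y (Suc i)" if "Suc (Suc i) < n" for i
    using path_eig_inner[OF y that] b0 by (simp add: sy h_def field_simps)
  have ti: "t i + t (Suc (Suc i)) = h * t (Suc i)" if "Suc (Suc i) < n" for i
  proof -
    have "\<beta> * (x i + x (Suc (Suc i))) = (2 * \<beta> - \<theta>) * x (Suc i) - 1"
      using path_eig_inner[OF x that] b0 by (simp add: sx)
    moreover have "(2 * \<beta> - \<theta>) * (1 / \<theta>) = 2 * \<beta> * (1 / \<theta>) - 1" using th0 by (simp add: field_simps)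
    ultimately have "\<beta> * (t i + t (Suc (Suc i))) = (2 * \<beta> - \<theta>) * t (Suc i)"
      unfolding t_def distrib_left by linarith
    then show ?thesis using b0 by (simp add: h_def field_simps)
  qed
  \<comment> \<open>The polar form of \<open>u^2 + v^2 - h u v\<close>, which is invariant under the
    recurrence step \<open>(u, v)\<close> to \<open>(v, h v - u)\<close>.\<close>
  define I where "I = (\<lambda>i. 2 * (y i * t i + y (Suc i) * t (Suc i)) - h * (y i * t (Suc i) + y (Suc i) * t i))"
  have "I (Suc i) = I i" if "Suc (Suc i) < n" for i
  proof -
    have "h * y (Suc i) * (t (Suc (Suc i)) - t i) = (y i + y (Suc (Suc i))) * (t (Suc (Suc i)) - t i)"
      "h * t (Suc i) * (y (Suc (Suc i)) - y i) = (t i + t (Suc (Suc i))) * (y (Suc (Suc i)) - y i)"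
      by (simp_all only: yi[OF that] ti[OF that])
    then show ?thesis unfolding I_def by (simp add: algebra_simps)
  qed
  then have Ii: "I i = I 0" if "Suc i < n" for i
    using that by (induction i) auto
  have yN: "y (n - 1) = - y 0" using path_eig_ends[OF y] sy by simp
  have "\<beta> * y (n - 2) = \<beta> * (- y 1)"
    using path_eig_last[OF y] path_eig_first[OF y] sy yN by simp
  then have yN1: "y (n - 2) = - y 1" using b0 by (metis mult_left_cancel)
  have "\<beta> * x (n - 2) = \<beta> * x 1"
    using path_eig_last[OF x] path_eig_first[OF x] xs by simp
  then have "x (n - 2) = x 1" using b0 by (metis mult_left_cancel)
  then have tN: "t (n - 2) = t 1" "t (n - 1) = t 0" using xs by (simp_all add: t_def)
  have "Suc (n - 2) = n - 1" using n by simp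
  \<comment> \<open>The pair at the far end is the first pair reversed, with \<open>y\<close>
    negated; \<open>I\<close> is unchanged by the reversal.\<close>
  then have "I (n - 2) = - I 0" unfolding I_def by (simp only: yN yN1 tN) (simp add: algebra_simps)
  then have "I 0 = 0" using Ii[of "n - 2"] n by simp
  then have I0: "2 * (y 0 * t 0 + y 1 * t 1) = h * (y 0 * t 1 + y 1 * t 0)" by (simp add: I_def)
  \<comment> \<open>\<open>r\<close> is the ratio \<open>y 1 / y 0\<close> prescribed by the end
    equation; \<open>t\<close> has the same ratio up to the defect
    \<open>1 / (\<theta> \<beta>)\<close>.\<close>
  define r where "r = (1 + \<beta> - \<theta>) / \<beta>"
  have y1: "y 1 = r * y 0" using path_eig_first[OF y] sy b0 by (simp add: r_def field_simps)
  have t1: "t 1 = r * t 0 - 1 / (\<theta> * \<beta>)"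
  proof -
    have "\<beta> * x 1 = (1 + \<beta> - \<theta>) * x 0 - 1" using path_eig_first[OF x] sx b0 by simp
    moreover have "(1 + \<beta> - \<theta>) * (1 / \<theta>) = 1 / \<theta> + \<beta> * (1 / \<theta>) - 1" using th0 by (simp add: field_simps)
    ultimately have "\<beta> * t 1 = (1 + \<beta> - \<theta>) * t 0 - 1 / \<theta>" unfolding t_def distrib_left by linarith
    moreover have "\<beta> * (r * t 0 - 1 / (\<theta> * \<beta>)) = (1 + \<beta> - \<theta>) * t 0 - 1 / \<theta>"
      using b0 th0 by (simp add: r_def field_simps)
    ultimately show ?thesis using b0 by (metis mult_left_cancel)
  qed
  have "y 0 * (2 * (t 0 + r * t 1)) = y 0 * (h * (t 1 + r * t 0))"
    using I0 unfolding y1 by (simp add: algebra_simps)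
  then have "2 * (t 0 + r * t 1) = h * (t 1 + r * t 0)" using y0 by simp
  then have "2 * t 0 * (1 - h * r + r * r) = (2 * r - h) / (\<theta> * \<beta>)"
    unfolding t1 by (simp add: algebra_simps diff_divide_distrib)
  moreover have "1 - h * r + r * r = (1 - \<alpha> * \<theta>) / (\<beta> * \<beta>)"
    using b0 unfolding h_def r_def by (simp add: field_simps) (simp add: b algebra_simps)
  moreover have "(2 * r - h) / (\<theta> * \<beta>) = (2 - \<theta>) / (\<theta> * (\<beta> * \<beta>))"
    using b0 th0 unfolding h_def r_def by (simp add: field_simps)
  ultimately have "2 * t 0 * ((1 - \<alpha> * \<theta>) / (\<beta> * \<beta>)) = (2 - \<theta>) / (\<theta> * (\<beta> * \<beta>))"
    by (simp only:)
  then have "2 * t 0 * ((1 - \<alpha> * \<theta>) / (\<beta> * \<beta>)) * (\<beta> * \<beta>) = (2 - \<theta>) / (\<theta> * (\<beta> * \<beta>)) * (\<beta> * \<beta>)"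
    by (simp only:)
  then have "2 * t 0 * (1 - \<alpha> * \<theta>) = (2 - \<theta>) / \<theta>" using b0 by simp
  then have "\<theta> * (2 * x 0 * (1 - \<alpha> * \<theta>)) = \<theta> * (2 * \<alpha> - 1)"
    using th0 by (simp add: t_def field_simps)
  then have "2 * x 0 * (1 - \<alpha> * \<theta>) = 2 * \<alpha> - 1" using th0 by (metis mult_left_cancel)
  \<comment> \<open>A second evaluation of \<open>x 0\<close>, from the sum of all equations;
    comparing the two gives the relation.\<close>
  moreover have "2 * x 0 = real n - \<theta> / \<beta>"
    using path_eig_ends[OF x] b0 unfolding sx xs by (simp add: field_simps)
  ultimately show ?thesis by simp
qed

text \<open>A two-dimensional eigenspace contains a nonzero \<open>y\<close> with sum zero and a
  nonzero \<open>w\<close> with \<open>w 0 = 0\<close>. A suitable combination of them meets the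
  normalisation of \<open>path_double_eigenvalue_core\<close>. Orthogonality of \<open>u\<close> and
  \<open>z\<close> serves to give independence.\<close>

lemma path_double_eigenvalue:
  assumes u: "is_eigenfun \<alpha> n (path_graph n) k u" and z: "is_eigenfun \<alpha> n (path_graph n) k z"
    and nz: "\<exists>i<n. u i \<noteq> 0" "\<exists>i<n. z i \<noteq> 0" and orth: "(\<Sum>i<n. u i * z i) = 0" and th0: "\<theta> \<noteq> 0"
  shows "(real n - \<theta> / \<beta>) * (1 - \<alpha> * \<theta>) = 2 * \<alpha> - 1"
proof -
  have pos: "(\<Sum>i<n. v i * v i) > 0" if nzv: "\<exists>i<n. v i \<noteq> 0" for v :: "nat \<Rightarrow> real"
  proof -
    obtain i where "i < n" "v i \<noteq> 0" using nzv by blast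
    then have "0 < v i * v i" by (auto simp: zero_less_mult_iff linorder_neq_iff)
    also have "v i * v i \<le> (\<Sum>i<n. v i * v i)"
      using \<open>i < n\<close> by (intro member_le_sum) auto
    finally show ?thesis .
  qed
  have ind: "p = 0 \<and> q = 0" if "\<forall>i<n. p * u i + q * z i = 0" for p q
  proof -
    have "(\<Sum>i<n. u i * (p * u i + q * z i)) = p * (\<Sum>i<n. u i * u i) + q * (\<Sum>i<n. u i * z i)"
      "(\<Sum>i<n. z i * (p * u i + q * z i)) = p * (\<Sum>i<n. u i * z i) + q * (\<Sum>i<n. z i * z i)"
      by (simp_all add: sum.distrib sum_distrib_left algebra_simps)
    moreover have "(\<Sum>i<n. u i * (p * u i + q * z i)) = 0" "(\<Sum>i<n. z i * (p * u i + q * z i)) = 0"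
      using that by (simp_all add: sum.neutral)
    ultimately have "p * (\<Sum>i<n. u i * u i) = 0" "q * (\<Sum>i<n. z i * z i) = 0"
      by (simp_all only: orth mult_zero_right add_0_right add_0_left)
    then show ?thesis using pos[OF nz(1)] pos[OF nz(2)] by (metis less_irrefl mult_eq_0_iff)
  qed
  \<comment> \<open>Every linear functional \<open>\<phi>\<close> on the plane has a nonzero kernel
    element: \<open>u\<close> itself, or \<open>\<phi> z\<close> times \<open>u\<close> minus
    \<open>\<phi> u\<close> times \<open>z\<close>.\<close>
  have combination: "\<exists>v. is_eigenfun \<alpha> n (path_graph n) k v \<and> (\<exists>i<n. v i \<noteq> 0) \<and> \<phi> v = 0"
    if lin: "\<And>p q. \<phi> (\<lambda>i. p * u i + q * z i) = p * \<phi> u + q * \<phi> z" for \<phi> :: "(nat \<Rightarrow> real) \<Rightarrow> real"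
  proof (cases "\<phi> u = 0")
    case True
    then show ?thesis using u nz by blast
  next
    case False
    let ?v = "\<lambda>i. \<phi> z * u i + (- \<phi> u) * z i"
    have "\<exists>i<n. ?v i \<noteq> 0" using ind[of "\<phi> z" "- \<phi> u"] False by auto
    moreover have "\<phi> ?v = 0" unfolding lin by simp
    ultimately show ?thesis using is_eigenfun_linear[OF u z] by blast
  qed
  obtain y where y: "is_eigenfun \<alpha> n (path_graph n) k y" "\<exists>i<n. y i \<noteq> 0" "(\<Sum>i<n. y i) = 0"
    using combination[of "\<lambda>v. \<Sum>i<n. v i"] by (auto simp: sum.distrib sum_distrib_left)
  obtain w where w: "is_eigenfun \<alpha> n (path_graph n) k w" "\<exists>i<n. w i \<noteq> 0" "w 0 = 0"
    using combination[of "\<lambda>v. v 0"] by auto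
  have y0: "y 0 \<noteq> 0" using path_eig_zero[OF y(1,3)] y(2) by blast
  have sw: "(\<Sum>i<n. w i) \<noteq> 0" using path_eig_zero[OF w(1) _ w(3)] w(2) by blast
  \<comment> \<open>\<open>p\<close> scales the sum to \<open>- 1 / \<beta>\<close>. Since
    \<open>w\<close> vanishes at 0 and \<open>y\<close> has opposite end values, adding
    \<open>c\<close> times \<open>y\<close> equalises the ends without changing the sum.\<close>
  define p where "p = - 1 / \<beta> / (\<Sum>i<n. w i)"
  define c where "c = p * w (n - 1) / (2 * y 0)"
  let ?x = "\<lambda>i. p * w i + c * y i"
  have yN: "y (n - 1) = - y 0" using path_eig_ends[OF y(1)] y(3) by simp
  show ?thesis
  proof (rule path_double_eigenvalue_core[OF is_eigenfun_linear[OF w(1) y(1)] y(1,3) y0 _ _ th0])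
    show "(\<Sum>i<n. ?x i) = - 1 / \<beta>"
    proof -
      have "(\<Sum>i<n. ?x i) = p * (\<Sum>i<n. w i) + c * (\<Sum>i<n. y i)"
        by (simp only: sum.distrib sum_distrib_left)
      then show ?thesis using sw y(3) by (simp add: p_def)
    qed
    show "?x 0 = ?x (n - 1)" using y0 by (simp add: w(3) yN[simplified] c_def field_simps)
  qed
qed

end

text \<open>The first alternative is that of a triangle, the second that of longer cycles. For
  \<open>g \<le> 2\<close> the left side is at least \<open>4 * (1/2)\<close>, while the right side
  is below 1; for \<open>g = 3\<close> completing the square leaves a gap of at least
  \<open>1/3\<close>.\<close>

lemma double_eigenvalue_arith:
  fixes \<alpha> g m :: real
  assumes a: "0 \<le> \<alpha>" "\<alpha> < 1" and g: "(g = 3 \<and> 5 \<le> m) \<or> (0 \<le> g \<and> g \<le> 2 \<and> 6 \<le> m)"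
    and eq: "(m - g) * (1 - \<alpha> * ((1 - \<alpha>) * g)) = 2 * \<alpha> - 1"
  shows False
  using g
proof
  assume g: "g = 3 \<and> 5 \<le> m"
  have p: "1 - \<alpha> * ((1 - \<alpha>) * 3) = 3 * (\<alpha> - 1/2)\<^sup>2 + 1/4"
    by (simp add: power2_eq_square algebra_simps)
  have "2 * (1 - \<alpha> * ((1 - \<alpha>) * 3)) \<le> (m - 3) * (1 - \<alpha> * ((1 - \<alpha>) * 3))"
    unfolding p by (rule mult_right_mono) (use g in auto)
  then have "2 * (1 - \<alpha> * ((1 - \<alpha>) * 3)) \<le> 2 * \<alpha> - 1" using eq g by simp
  moreover have "2 * (1 - \<alpha> * ((1 - \<alpha>) * 3)) - (2 * \<alpha> - 1) = 6 * (\<alpha> - 2/3)\<^sup>2 + 1/3"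
    by (simp add: power2_eq_square algebra_simps)
  moreover have "6 * (\<alpha> - 2/3)\<^sup>2 \<ge> 0" by simp
  ultimately show False by linarith
next
  assume g: "0 \<le> g \<and> g \<le> 2 \<and> 6 \<le> m"
  have "\<alpha> * (1 - \<alpha>) = 1/4 - (\<alpha> - 1/2)\<^sup>2" by (simp add: power2_eq_square algebra_simps)
  then have q: "\<alpha> * (1 - \<alpha>) \<le> 1/4" by simp
  have "\<alpha> * (1 - \<alpha>) * g \<le> 1/4 * 2" by (rule mult_mono[OF q]) (use g in auto)
  then have h: "1 - \<alpha> * ((1 - \<alpha>) * g) \<ge> 1/2" by (simp add: mult.assoc)
  have "4 * (1/2) \<le> (m - g) * (1 - \<alpha> * ((1 - \<alpha>) * g))" by (rule mult_mono) (use g h in auto)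
  then show False using eq a by simp
qed

lemma two_pi_div_less_pi: "3 \<le> x \<Longrightarrow> 0 < 2 * pi / x \<and> 2 * pi / x < pi" for x :: real
  by (auto simp: field_simps)

section \<open>Eigenvectors supported on a cycle component\<close>

context
  fixes n :: nat and E :: "nat \<Rightarrow> nat \<Rightarrow> bool" and ys :: "nat list"
  assumes G: "simple_graph n E" and dist: "distinct ys" and sub: "set ys \<subseteq> {..<n}" and l3: "3 \<le> length ys"
    and deg: "\<And>i. i < length ys \<Longrightarrow> degree n E (ys ! i) = 2"
    and nb: "\<And>i w. i < length ys \<Longrightarrow> E (ys ! i) w \<longleftrightarrow>
       w = ys ! (Suc i mod length ys) \<or> w = ys ! ((i + length ys - 1) mod length ys)"
begin

private abbreviation "l \<equiv> length ys"

text \<open>Extends \<open>h\<close> by zero off the cycle; the form as a sum lets sums over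
  vertices be exchanged with sums over positions.\<close>

definition cycle_vec :: "(nat \<Rightarrow> real) \<Rightarrow> nat \<Rightarrow> real" where
  "cycle_vec h v = (\<Sum>i<l. if v = ys ! i then h i else 0)"

lemma cycle_vec_nth: "i < l \<Longrightarrow> cycle_vec h (ys ! i) = h i"
proof -
  assume i: "i < l"
  have "cycle_vec h (ys ! i) = (\<Sum>j<l. if j = i then h i else 0)"
    unfolding cycle_vec_def using dist i by (intro sum.cong) (auto simp: nth_eq_iff_index_eq)
  then show ?thesis using i by simp
qed

lemma cycle_vec_outside: "v \<notin> set ys \<Longrightarrow> cycle_vec h v = 0"
  unfolding cycle_vec_def by (intro sum.neutral) auto

text \<open>On the cycle, adjacency joins each position to its cyclic successor and predecessor; off
  the cycle both sides vanish, as no edge leaves the cycle.\<close>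

lemma sum_adj_cycle_vec:
  assumes h: "\<And>i. i < l \<Longrightarrow> h (Suc i mod l) + h ((i + l - 1) mod l) = c * h i"
  shows "(\<Sum>w<n. adj E v w * cycle_vec h w) = c * cycle_vec h v"
proof -
  have "(\<Sum>w<n. adj E v w * cycle_vec h w) = (\<Sum>w<n. \<Sum>i<l. if w = ys ! i then adj E v (ys ! i) * h i else 0)"
    unfolding cycle_vec_def sum_distrib_left by (intro sum.cong) auto
  also have "\<dots> = (\<Sum>i<l. \<Sum>w<n. if w = ys ! i then adj E v (ys ! i) * h i else 0)" by (rule sum.swap)
  also have "\<dots> = (\<Sum>i<l. adj E v (ys ! i) * h i)"
    using sub by (intro sum.cong) (auto simp: subset_iff)
  finally have *: "(\<Sum>w<n. adj E v w * cycle_vec h w) = (\<Sum>i<l. adj E v (ys ! i) * h i)" .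
  show ?thesis
  proof (cases "v \<in> set ys")
    case True
    then obtain m where m: "m < l" "v = ys ! m" by (auto simp: in_set_conv_nth)
    let ?p = "Suc m mod l" and ?q = "(m + l - 1) mod l"
    have "0 < l" using l3 by linarith
    then have lt: "?p < l" "?q < l" by (rule mod_less_divisor)+
    have ne: "?p \<noteq> ?q" unfolding pred_mod[OF m(1)] Suc_mod[OF m(1)] using l3 m by auto
    have "(\<Sum>i<l. adj E v (ys ! i) * h i) = (\<Sum>i<l. (if i = ?p then h ?p else 0) + (if i = ?q then h ?q else 0))"
    proof (rule sum.cong[OF refl])
      fix i assume i: "i \<in> {..<l}"
      then have "E v (ys ! i) \<longleftrightarrow> i = ?p \<or> i = ?q"
        using nb[OF m(1), of "ys ! i"] m dist lt by (simp add: nth_eq_iff_index_eq)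
      then show "adj E v (ys ! i) * h i = (if i = ?p then h ?p else 0) + (if i = ?q then h ?q else 0)"
        using ne by (auto simp: adj_def)
    qed
    also have "\<dots> = h ?p + h ?q" using lt by (simp add: sum.distrib)
    also have "\<dots> = c * h m" by (rule h[OF m(1)])
    finally show ?thesis using * m by (simp add: cycle_vec_nth)
  next
    case False
    have "\<not> E v (ys ! i)" if i: "i < l" for i
    proof
      assume "E v (ys ! i)"
      then have "E (ys ! i) v" using G by (auto simp: simple_graph_def)
      moreover have "0 < l" using l3 by linarith
      ultimately show False using nb[OF i, of v] False nth_mem mod_less_divisor by metis
    qed
    then have "(\<Sum>i<l. adj E v (ys ! i) * h i) = 0" by (intro sum.neutral) (auto simp: adj_def)
    then show ?thesis using * False by (simp add: cycle_vec_outside)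
  qed
qed

lemma degree_cycle_vec: "real (degree n E v) * cycle_vec h v = 2 * cycle_vec h v"
  by (cases "v \<in> set ys") (auto simp: in_set_conv_nth deg cycle_vec_outside)

text \<open>Summing the adjacency equation over all vertices gives \<open>2 c S = 2 S\<close>, so
  the sum \<open>S\<close> is 0 and the all-ones part drops out. The eigenvalue is then
  \<open>- 2 (1 - \<alpha>) c - 2 \<alpha>\<close>.\<close>

lemma cycle_vec_is_eigenfun:
  assumes h: "\<And>i. i < l \<Longrightarrow> h (Suc i mod l) + h ((i + l - 1) mod l) = 2 * c * h i" and c: "c \<noteq> 1"
  shows "is_eigenfun \<alpha> n E (2 * (1 - \<alpha>) * (1 - c) - 2) (cycle_vec h)"
proof -
  have a: "(\<Sum>w<n. adj E v w * cycle_vec h w) = 2 * c * cycle_vec h v" for v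
    by (rule sum_adj_cycle_vec[OF h])
  have "2 * c * (\<Sum>v<n. cycle_vec h v) = (\<Sum>v<n. \<Sum>w<n. adj E v w * cycle_vec h w)"
    unfolding a by (simp add: sum_distrib_left)
  also have "\<dots> = (\<Sum>v<n. 2 * cycle_vec h v)" unfolding sum_adj_right[OF G] degree_cycle_vec ..
  also have "\<dots> = 2 * (\<Sum>v<n. cycle_vec h v)" by (simp add: sum_distrib_left)
  finally have s: "(\<Sum>v<n. cycle_vec h v) = 0" using c by simp
  show ?thesis unfolding is_eigenfun_def s a mult.assoc[of \<alpha>] degree_cycle_vec by (auto simp: algebra_simps)
qed

text \<open>Cosine and sine of the multiples of \<open>2 pi / l\<close> satisfy the cyclic
  recurrence by the addition formulas. Positions 0 and 1 of the cycle show that they are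
  independent.\<close>

lemma cycle_two_eigenvectors:
  assumes c: "c = cos (2 * pi / l)"
  obtains v w where "is_eigenfun \<alpha> n E (2 * (1 - \<alpha>) * (1 - c) - 2) v" "is_eigenfun \<alpha> n E (2 * (1 - \<alpha>) * (1 - c) - 2) w"
    "\<exists>i<n. v i \<noteq> 0" "\<And>a. \<exists>i<n. w i \<noteq> a * v i"
proof -
  define \<omega> where "\<omega> = 2 * pi / l"
  have l3r: "real l \<ge> 3" using l3 by simp
  then have l0: "real l > 0" by linarith
  have lw: "real l * \<omega> = 2 * pi" using l0 unfolding \<omega>_def by simp
  have w: "0 < \<omega>" "\<omega> < pi" using two_pi_div_less_pi[OF l3r] by (auto simp: \<omega>_def)
  then have c1: "c \<noteq> 1" using c cos_monotone_0_pi[of 0 \<omega>] unfolding \<omega>_def by auto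
  \<comment> \<open>Wrapping around the cycle changes the angle by a multiple of
    \<open>2 pi\<close>, which cosine and sine ignore.\<close>
  have nx: "\<exists>m::int. real (Suc i mod l) * \<omega> = real i * \<omega> + \<omega> + 2 * pi * m" if "i < l" for i
  proof (cases "Suc i = l")
    case True
    then have "real i * \<omega> + \<omega> = 2 * pi" using lw by (metis distrib_right mult_1 of_nat_Suc add.commute)
    then show ?thesis using True by (intro exI[of _ "-1"]) simp
  qed (use that in \<open>auto intro!: exI[of _ "0::int"] simp: algebra_simps\<close>)
  have pv: "\<exists>m::int. real ((i + l - 1) mod l) * \<omega> = real i * \<omega> - \<omega> + 2 * pi * m" if "i < l" for i
    unfolding pred_mod[OF that]
  proof (cases "i = 0")
    case True
    have "real (l - 1) * \<omega> = 2 * pi - \<omega>" using lw l3 by (simp add: of_nat_diff left_diff_distrib)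
    then show "\<exists>m::int. real (if i = 0 then l - 1 else i - 1) * \<omega> = real i * \<omega> - \<omega> + 2 * pi * m"
      using True by (intro exI[of _ 1]) simp
  next
    case False
    then show "\<exists>m::int. real (if i = 0 then l - 1 else i - 1) * \<omega> = real i * \<omega> - \<omega> + 2 * pi * m"
      by (intro exI[of _ 0]) (auto simp: of_nat_diff algebra_simps)
  qed
  let ?v = "\<lambda>i. cos (real i * \<omega>)" and ?w = "\<lambda>i. sin (real i * \<omega>)"
  have per: "cos (x + 2 * pi * m) = cos x" "sin (x + 2 * pi * m) = sin x" for x and m :: int
    by (simp_all add: cos_add sin_add)
  have hv: "?v (Suc i mod l) + ?v ((i + l - 1) mod l) = 2 * c * ?v i" if i: "i < l" for i
  proof -
    have "?v (Suc i mod l) = cos (real i * \<omega> + \<omega>)" using nx[OF i] per by metis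
    moreover have "?v ((i + l - 1) mod l) = cos (real i * \<omega> - \<omega>)" using pv[OF i] per by metis
    ultimately show ?thesis by (simp add: cos_add cos_diff c \<omega>_def)
  qed
  have hw: "?w (Suc i mod l) + ?w ((i + l - 1) mod l) = 2 * c * ?w i" if i: "i < l" for i
  proof -
    have "?w (Suc i mod l) = sin (real i * \<omega> + \<omega>)" using nx[OF i] per by metis
    moreover have "?w ((i + l - 1) mod l) = sin (real i * \<omega> - \<omega>)" using pv[OF i] per by metis
    ultimately show ?thesis by (simp add: sin_add sin_diff c \<omega>_def)
  qed
  have i01: "0 < l" "1 < l" using l3 by auto
  have n01: "ys ! 0 < n" "ys ! 1 < n" using sub i01 nth_mem by blast+
  have v0: "cycle_vec ?v (ys ! 0) = 1" and w0: "cycle_vec ?w (ys ! 0) = 0" and w1: "cycle_vec ?w (ys ! 1) = sin \<omega>"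
    using cycle_vec_nth i01 by (simp_all only: cycle_vec_nth[OF i01(1)] cycle_vec_nth[OF i01(2)]) simp_all
  have "\<exists>i<n. cycle_vec ?w i \<noteq> a * cycle_vec ?v i" for a
  proof (cases "a = 0")
    case True
    then show ?thesis using n01 w1 sin_gt_zero[OF w] by (intro exI[of _ "ys ! 1"]) auto
  next
    case False
    then show ?thesis using n01 v0 w0 by (intro exI[of _ "ys ! 0"]) auto
  qed
  moreover have "\<exists>i<n. cycle_vec ?v i \<noteq> 0" using n01 v0 by (intro exI[of _ "ys ! 0"]) auto
  ultimately show thesis using that cycle_vec_is_eigenfun[OF hv c1] cycle_vec_is_eigenfun[OF hw c1] by blast
qed

text \<open>The double eigenvalue of the cycle is transferred to the path by cospectrality. There
  \<open>k + 2 = (1 - \<alpha>) g\<close>, so the relation for double eigenvalues takes the form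
  that \<open>double_eigenvalue_arith\<close> excludes.\<close>

lemma cycle_not_cospectral_path:
  assumes a: "0 \<le> \<alpha>" "\<alpha> < 1" and ln: "l + 2 \<le> n"
    and eq: "char_poly (shifted_compl_mat \<alpha> n E) = char_poly (shifted_compl_mat \<alpha> n (path_graph n))"
  shows False
proof -
  define c where "c = cos (2 * pi / l)"
  define g where "g = 2 * (1 - c)"
  define k where "k = (1 - \<alpha>) * g - 2"
  have k: "2 * (1 - \<alpha>) * (1 - c) - 2 = k" by (simp add: k_def g_def algebra_simps)
  obtain v w where v: "is_eigenfun \<alpha> n E k v" "\<exists>i<n. v i \<noteq> 0" and w: "is_eigenfun \<alpha> n E k w" "\<And>a. \<exists>i<n. w i \<noteq> a * v i"
    using cycle_two_eigenvectors[OF c_def, of \<alpha>] unfolding k by metis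
  have "vec n v \<noteq> 0\<^sub>v n" using v(2) by (auto simp: vec_eq_iff)
  moreover have "vec n w \<noteq> a \<cdot>\<^sub>v vec n v" for a using w(2)[of a] by (auto simp: vec_eq_iff)
  ultimately obtain u z where u: "u \<in> carrier_vec n" "shifted_compl_mat \<alpha> n (path_graph n) *\<^sub>v u = k \<cdot>\<^sub>v u" "u \<noteq> 0\<^sub>v n"
    and z: "z \<in> carrier_vec n" "shifted_compl_mat \<alpha> n (path_graph n) *\<^sub>v z = k \<cdot>\<^sub>v z" "z \<noteq> 0\<^sub>v n" and uz: "u \<bullet> z = 0"
    using cospectral_two_eigenvectors[OF shifted_compl_mat_carrier shifted_compl_mat_carrier
        shifted_compl_mat_transpose[OF simple_path_graph] eq _ v(1)[unfolded is_eigenfun_iff_mult_mat_vec] _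
        w(1)[unfolded is_eigenfun_iff_mult_mat_vec]]
    by (metis vec_carrier)
  have uv: "vec n (($) u) = u" "vec n (($) z) = z" using u z by auto
  have l0: "real l \<ge> 3" using l3 by simp
  have ang: "0 < 2 * pi / l" "2 * pi / l < pi" using two_pi_div_less_pi[OF l0] by auto
  have "c < 1" using cos_monotone_0_pi[of 0 "2 * pi / l"] ang unfolding c_def by simp
  then have g0: "g > 0" by (simp add: g_def)
  \<comment> \<open>A triangle has \<open>c = - 1/2\<close>; from length 4 on the angle is at most
    \<open>pi / 2\<close>, so \<open>c \<ge> 0\<close> and \<open>g \<le> 2\<close>.\<close>
  have gcase: "(g = 3 \<and> 5 \<le> real n) \<or> (0 \<le> g \<and> g \<le> 2 \<and> 6 \<le> real n)"
  proof (cases "l = 3")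
    case True
    have "c = - 1 / 2" unfolding c_def True using cos_120 by (simp add: mult.commute)
    then show ?thesis using True ln by (simp add: g_def)
  next
    case False
    then have l4: "real l \<ge> 4" using l3 by simp
    then have "2 * pi / l \<le> 2 * pi / 4" by (intro divide_left_mono) auto
    then have "2 * pi / l \<le> pi / 2" by simp
    then have "c \<ge> 0" unfolding c_def using ang by (intro cos_ge_zero) auto
    then show ?thesis using g0 l4 ln by (simp add: g_def)
  qed
  have "(real n - (k + 2) / (1 - \<alpha>)) * (1 - \<alpha> * (k + 2)) = 2 * \<alpha> - 1"
  proof (rule path_double_eigenvalue[OF refl _ refl])
    show "is_eigenfun \<alpha> n (path_graph n) k (($) u)" "is_eigenfun \<alpha> n (path_graph n) k (($) z)"
      unfolding is_eigenfun_iff_mult_mat_vec uv using u z by auto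
    show "\<exists>i<n. u $ i \<noteq> 0" "\<exists>i<n. z $ i \<noteq> 0" using u z by (auto simp: vec_eq_iff)
    show "(\<Sum>i<n. u $ i * z $ i) = 0" using uz z by (simp add: scalar_prod_def atLeast0LessThan)
    show "3 \<le> n" using ln l3 by simp
  qed (use a g0 in \<open>auto simp: k_def\<close>)
  then have "(real n - g) * (1 - \<alpha> * ((1 - \<alpha>) * g)) = 2 * \<alpha> - 1" using a by (simp add: k_def)
  then show False using double_eigenvalue_arith[OF a gcase] by simp
qed

end

section \<open>From equal spectra to an isomorphism with the complement of the path\<close>

text \<open>Joins the cases of positive and zero \<open>\<alpha>\<close>. At
  \<open>\<alpha> = 0\<close> the excess argument starts at \<open>n = 3\<close>; for
  \<open>n = 2\<close> degrees are 0 or 1, so both moments are equal to 2.\<close>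

lemma cospectral_path_degrees:
  assumes G: "simple_graph n E" and n: "2 \<le> n" and a: "0 \<le> \<alpha>"
    and eq: "char_poly (shifted_compl_mat \<alpha> n E) = char_poly (shifted_compl_mat \<alpha> n (path_graph n))"
  shows "deg_sum n E = 2 * real n - 2" "deg_sqsum n E = 4 * real n - 6"
proof -
  have "deg_sum n E = 2 * real n - 2 \<and> deg_sqsum n E = 4 * real n - 6"
  proof (cases "\<alpha> = 0")
    case False
    then show ?thesis
      using cospectral_degrees_pos[OF G simple_path_graph _ eq] a deg_sum_path[OF n] deg_sqsum_path[OF n]
      by (simp add: deg_sum_def deg_sqsum_def)
  next
    case True
    note eq0 = eq[unfolded True]
    have s: "deg_sum n E = 2 * real n - 2"
      using cospectral_moments(1)[OF G simple_path_graph eq0] deg_sum_path[OF n] by simp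
    show ?thesis
    proof (cases "3 \<le> n")
      case True
      then show ?thesis using s cospectral_deg_sqsum_zero[OF G True eq0] by simp
    next
      case False
      then have n2: "n = 2" using n by simp
      have "degree n E i \<le> 1" if "i < n" for i
      proof -
        have "{j \<in> {0..<n}. E i j} \<subseteq> {0..<n} - {i}" using G by (auto simp: simple_graph_def)
        then have "degree n E i \<le> card ({0..<n} - {i})" unfolding degree_def by (intro card_mono) auto
        then show ?thesis using that n2 by simp
      qed
      then have sq: "(real (degree n E i))\<^sup>2 = real (degree n E i)" if "i < n" for i
        using that by (metis le_neq_implies_less less_one of_nat_0 of_nat_1 power_one zero_power2)
      have "deg_sqsum n E = deg_sum n E" unfolding deg_sqsum_def deg_sum_def
        by (intro sum.cong refl sq) simp
      then show ?thesis using s n2 by simp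
    qed
  qed
  then show "deg_sum n E = 2 * real n - 2" "deg_sqsum n E = 4 * real n - 6" by auto
qed

theorem theorem2p5:
  fixes n :: nat and \<alpha> :: real
  assumes "0 \<le> \<alpha>" and "\<alpha> < 1"
  shows "determined_by_A_alpha_spectrum \<alpha> n (compl_graph n (path_graph n))"
  unfolding determined_by_A_alpha_spectrum_def
proof (intro allI impI, elim conjE)
  fix m F
  assume F: "simple_graph m F"
    and spec: "A_alpha_spectrum \<alpha> m F = A_alpha_spectrum \<alpha> n (compl_graph n (path_graph n))"
  note cosp = cospectral_imp_char_poly_eq[OF A_alpha_carrier A_alpha_carrier spec[unfolded A_alpha_spectrum_def]]
  have m: "m = n" by (rule cosp(1))
  note F = F[unfolded m]
  define H where "H = compl_graph n F"
  have H: "simple_graph n H" unfolding H_def by (rule simple_graph_compl[OF F])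
  have FH: "F = compl_graph n H" unfolding H_def by (simp add: compl_compl[OF F])
  have eq: "char_poly (shifted_compl_mat \<alpha> n H) = char_poly (shifted_compl_mat \<alpha> n (path_graph n))"
    using cospectral_shifted_compl_mat[OF H simple_path_graph] cosp(2) unfolding m FH by blast
  show "graph_iso m F n (compl_graph n (path_graph n))"
  proof (cases "2 \<le> n")
    case False
    have "F i j = compl_graph n (path_graph n) i j" if "i < n" "j < n" for i j
    proof -
      have "i = j" using that False by linarith
      then show ?thesis using F by (auto simp: simple_graph_def compl_graph_def)
    qed
    then show ?thesis unfolding m graph_iso_def by (intro exI[of _ id]) auto
  next
    case True
    note s = cospectral_path_degrees[OF H True assms(1) eq]
    have "real (\<Sum>i<n. degree n H i) = real (2 * n - 2)" using s(1) True by (simp add: deg_sum_def of_nat_diff)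
    then have sn: "(\<Sum>i<n. degree n H i) = 2 * n - 2" by (simp only: of_nat_eq_iff)
    have "1 \<le> n" using True by simp
    note dichotomy = path_graph_or_cycle[OF H this degrees_one_two[OF s] sn]
    have no_cycle: False if ys: "distinct ys" "set ys \<subseteq> {..<n}" "3 \<le> length ys" "length ys + 2 \<le> n"
        and nb: "\<forall>i<length ys. degree n H (ys ! i) = 2 \<and> (\<forall>w. H (ys ! i) w \<longleftrightarrow>
          w = ys ! (Suc i mod length ys) \<or> w = ys ! ((i + length ys - 1) mod length ys))" for ys
      by (rule cycle_not_cospectral_path[OF H ys(1-3) _ _ assms ys(4) eq]) (use nb in blast)+
    have "\<exists>xs. distinct xs \<and> set xs = {..<n} \<and> (\<forall>i<n. \<forall>j<n. H (xs ! i) (xs ! j) \<longleftrightarrow> path_graph n i j)"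
    proof (rule disjE[OF dichotomy])
      assume "\<exists>ys. distinct ys \<and> set ys \<subseteq> {..<n} \<and> 3 \<le> length ys \<and> length ys + 2 \<le> n \<and>
       (\<forall>i<length ys. degree n H (ys ! i) = 2 \<and> (\<forall>w. H (ys ! i) w \<longleftrightarrow>
       w = ys ! (Suc i mod length ys) \<or> w = ys ! ((i + length ys - 1) mod length ys)))"
      then have False by (elim exE conjE) (rule no_cycle)
      then show ?thesis by (rule FalseE)
    qed
    then obtain xs where xs: "distinct xs" "set xs = {..<n}"
      and iso: "\<forall>i<n. \<forall>j<n. H (xs ! i) (xs ! j) \<longleftrightarrow> path_graph n i j" by (elim exE conjE)
    have l: "length xs = n" using distinct_card[OF xs(1)] xs(2) by simp
    have bij: "bij_betw ((!) xs) {0..<n} {0..<n}"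
      using bij_betw_nth[OF xs(1)] l xs(2) by (simp add: atLeast0LessThan)
    \<comment> \<open>The list sends positions to vertices, so its inverse, from vertices to
      positions, is the isomorphism in the required direction.\<close>
    let ?f = "inv_into {0..<n} ((!) xs)"
    have f: "?f i < n" "xs ! ?f i = i" if "i < n" for i
      using that bij bij_betw_inv_into_right[OF bij] bij_betw_apply[OF bij_betw_inv_into[OF bij]] by auto
    have "F i j \<longleftrightarrow> compl_graph n (path_graph n) (?f i) (?f j)" if ij: "i < n" "j < n" for i j
    proof -
      have "H i j \<longleftrightarrow> path_graph n (?f i) (?f j)" using iso[rule_format, of "?f i" "?f j"] f ij by simp
      moreover have "i = j \<longleftrightarrow> ?f i = ?f j" using f ij by metis
      ultimately show ?thesis using f ij unfolding FH by (simp add: compl_graph_def)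
    qed
    then show ?thesis unfolding m graph_iso_def using bij_betw_inv_into[OF bij] by blast
  qed
qed

end
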